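(* Let $\Omega$ be a domain of $\mathbb{R}^2$, $1<p<\infty$, and let $\nu\in\mathbb{R}$, $\nu\neq 1/2$, $\nu\ne 3/4$. The two-dimensional elasticity operator $$Eu=\Delta u+(1-2\nu)^{-1}\nabla\,\mathrm{div}\,u$$ is $L^p$-dissipative (on real vector-valued functions) if and only if $$\left(\frac12-\frac1p\right)^2\leq\frac{2(\nu-1)(2\nu-1)}{(3-4\nu)^2}.$$
   Context: All functions here are real vector valued. $(C_0^1(\Omega))^2$ is the space of $C^1$ functions $u:\Omega\to\mathbb{R}^2$ with compact support in $\Omega$. The bilinear form of $E$ is $$\mathscr{L}(u,v)=\int_\Omega\Big(\sum_{j=1}^2\nabla u_j\cdot\nabla v_j+(1-2\nu)^{-1}\,\mathrm{div}\,u\;\mathrm{div}\,v\Big)dx .$$ With $p'=p/(p-1)$, $E$ is called $L^p$-dissipative if for all $u\in(C_0^1(\Omega))^2$: $\mathscr{L}(u,|u|^{p-2}u)\geq0$ when $p\geq2$, and $\mathscr{L}(|u|^{p'-2}u,u)\geq0$ when $1<p<2$. Here $\nu$ is the Poisson ratio. *)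

theory Defs
  imports "HOL-Analysis.Analysis"
begin

text \<open>
  A field on \<open>\<Omega>\<close> is a total function whose values outside \<open>\<Omega>\<close> are irrelevant; the closure
  in the plane being contained in \<open>\<Omega>\<close> makes it agree with the closure relative to \<open>\<Omega>\<close>.
\<close>

definition C1_compact_support :: "(real^2) set \<Rightarrow> (real^2 \<Rightarrow> real^2) set" where
  "C1_compact_support \<Omega> =
    {u. u differentiable_on \<Omega> \<and> continuous_on \<Omega> (\<lambda>x. jacobian u (at x)) \<and>
        compact (closure {x\<in>\<Omega>. u x \<noteq> 0}) \<and> closure {x\<in>\<Omega>. u x \<noteq> 0} \<subseteq> \<Omega>}"

text \<open>Row \<open>j\<close> of the Jacobian matrix is the gradient of the component \<open>u\<^sub>j\<close>.\<close>

definition grad_comp :: "(real^2 \<Rightarrow> real^2) \<Rightarrow> 2 \<Rightarrow> real^2 \<Rightarrow> real^2" where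
  "grad_comp u j x = jacobian u (at x) $ j"

definition divergence :: "(real^2 \<Rightarrow> real^2) \<Rightarrow> real^2 \<Rightarrow> real" where
  "divergence u x = trace (jacobian u (at x))"

text \<open>
  The bilinear form of \<open>E u = \<Delta> u + (1 - 2\<nu>)\<^sup>-\<^sup>1 \<nabla> div u\<close>, that is, the weak form of
  \<open>- \<integral>\<^sub>\<Omega> E u \<bullet> v\<close> obtained by integrating by parts.
\<close>

definition elasticity_form ::
    "real \<Rightarrow> (real^2) set \<Rightarrow> (real^2 \<Rightarrow> real^2) \<Rightarrow> (real^2 \<Rightarrow> real^2) \<Rightarrow> real" where
  "elasticity_form \<nu> \<Omega> u v =
    (LINT x:\<Omega>|lborel. (\<Sum>j\<in>UNIV. grad_comp u j x \<bullet> grad_comp v j x)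
                        + inverse (1 - 2 * \<nu>) * (divergence u x * divergence v x))"

text \<open>
  \<open>0 powr a = 0\<close> for every \<open>a\<close>, so \<open>|u|\<^sup>a u\<close> vanishes wherever \<open>u\<close> does. The exponents
  below are non-negative for \<open>1 < p\<close>, so both arguments of the form are \<open>C\<^sup>1\<close> on \<open>\<Omega>\<close>.
\<close>

definition Lp_dissipative_elasticity :: "real \<Rightarrow> real \<Rightarrow> (real^2) set \<Rightarrow> bool" where
  "Lp_dissipative_elasticity p \<nu> \<Omega> \<longleftrightarrow>
    (\<forall>u \<in> C1_compact_support \<Omega>.
      if p \<ge> 2
      then elasticity_form \<nu> \<Omega> u (\<lambda>x. (norm (u x) powr (p - 2)) *\<^sub>R u x) \<ge> 0
      else elasticity_form \<nu> \<Omega> (\<lambda>x. (norm (u x) powr (p / (p - 1) - 2)) *\<^sub>R u x) u \<ge> 0)"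

end

theory Submission
  imports Defs
begin

text \<open>
  Put \<open>\<gamma> = 1 / (1 - 2 \<nu>)\<close>. The form is symmetric and the inequality is invariant under
  \<open>p \<mapsto> p / (p - 1)\<close>, so \<open>p \<ge> 2\<close> may be assumed; the inequality then says
  \<open>|\<gamma>| p \<le> 2 (2 + \<gamma>) \<surd>(p - 1)\<close>.

  Sufficiency: at each point write the Jacobian of \<open>u\<close> in the orthonormal basis whose first vector
  is \<open>u / |u|\<close>. Adding a suitable multiple of the determinant of the Jacobian of
  \<open>|u|\<^bsup>(p - 2) / 2\<^esup> u\<close> makes the integrand a nonnegative quadratic form in the four entries, and
  the integral of such a determinant is zero.

  Necessity: testing with \<open>\<psi> (e + \<epsilon> sin (\<xi> \<bullet> x / \<epsilon> + \<theta>) v)\<close>, letting \<open>\<epsilon> \<rightarrow> 0\<close> and then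
  \<open>|v| \<rightarrow> \<infinity>\<close>, shows that the quadratic form at \<open>u = e\<close> is nonnegative on the rank-one matrices
  \<open>v \<otimes> \<xi>\<close>. The vectors \<open>e = (1, 0)\<close>, \<open>\<xi> = (1, 1)\<close>, \<open>v = (1, \<plusminus>\<surd>(p - 1))\<close> give the inequality.
\<close>

section \<open>The integral of a Jacobian determinant\<close>

text \<open>The field lives on the whole plane and its Jacobian \<open>J\<close> is an explicit
  parameter. The chain rule, continuity on a box and the change of variables then need no reference
  to \<open>\<Omega>\<close>.\<close>

definition C1_supported_in :: "(real^2) set \<Rightarrow> (real^2 \<Rightarrow> real^2) \<Rightarrow> (real^2 \<Rightarrow> real^2^2) \<Rightarrow> bool" where
  "C1_supported_in S U J \<longleftrightarrow>
    compact S \<and> (\<forall>x. (U has_derivative (\<lambda>h. J x *v h)) (at x)) \<and> continuous_on UNIV J \<and>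
    (\<forall>x. x \<notin> S \<longrightarrow> U x = 0)"

lemma has_derivative_matrix_unique:
  fixes f :: "real^'n \<Rightarrow> real^'m"
  assumes "(f has_derivative (\<lambda>h. A *v h)) (at x)" "(f has_derivative (\<lambda>h. B *v h)) (at x)"
  shows "A = B"
  using fun_cong[OF has_derivative_unique[OF assms]] unfolding matrix_eq by blast

lemma C1_supported_in_jacobian_eq_0:
  assumes "C1_supported_in S U J" "x \<notin> S"
  shows "J x = 0"
proof -
  have "open (- S)" using assms by (auto simp: C1_supported_in_def compact_imp_closed)
  moreover have "((\<lambda>_. 0 :: real^2) has_derivative (\<lambda>h. 0 *v h)) (at x)"
    by (simp add: matrix_vector_mult_0)
  moreover have "0 = U y" if "y \<in> - S" for y
    using assms(1) that by (simp add: C1_supported_in_def)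
  ultimately have "(U has_derivative (\<lambda>h. 0 *v h)) (at x)"
    using assms(2) has_derivative_transform_within_open[of "\<lambda>_. 0" "\<lambda>h. 0 *v h" x UNIV "- S" U]
    by simp
  moreover have "(U has_derivative (\<lambda>h. J x *v h)) (at x)"
    using assms(1) by (simp add: C1_supported_in_def)
  ultimately show ?thesis
    using has_derivative_matrix_unique by blast
qed

lemma C1_supported_in_bounded_jacobian:
  assumes "C1_supported_in S U J"
  obtains C where "C > 0" "\<And>x i j. \<bar>J x $ i $ j\<bar> \<le> C"
proof -
  have "bounded (J ` S)"
    using assms unfolding C1_supported_in_def
    by (meson compact_imp_bounded compact_continuous_image continuous_on_subset subset_UNIV)
  then obtain C where C: "C > 0" "\<And>x. x \<in> S \<Longrightarrow> norm (J x) \<le> C"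
    unfolding bounded_pos by auto
  have "\<bar>J x $ i $ j\<bar> \<le> C" for x i j
  proof (cases "x \<in> S")
    case True
    have "\<bar>J x $ i $ j\<bar> \<le> norm (J x $ i)" by (metis component_le_norm_cart)
    also have "\<dots> \<le> norm (J x)" by (metis Finite_Cartesian_Product.norm_nth_le)
    finally show ?thesis using C(2)[OF True] by simp
  next
    case False
    then show ?thesis using C1_supported_in_jacobian_eq_0[OF assms] C(1) by simp
  qed
  then show thesis using C that by blast
qed

lemma det_id_plus_scaleR_2:
  fixes A :: "real^2^2"
  shows "det (mat 1 + t *\<^sub>R A) = 1 + t * trace A + t\<^sup>2 * det A"
  by (simp add: det_2 trace_def sum_2 mat_def algebra_simps power2_eq_square)

text \<open>The perturbation is a contraction: points with equal images satisfy
  \<open>norm (x - y) \<le> t * L * norm (x - y)\<close>, which forces them to coincide.\<close>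

lemma inj_perturbation_of_id:
  fixes U :: "'a::banach \<Rightarrow> 'a"
  assumes lip: "\<And>x y. norm (U x - U y) \<le> L * norm (x - y)" and "0 \<le> t" "t * L < 1"
  shows "inj (\<lambda>x. x + t *\<^sub>R U x)"
proof (rule injI)
  fix x y assume "x + t *\<^sub>R U x = y + t *\<^sub>R U y"
  then have "x - y = t *\<^sub>R (U y - U x)" by (simp add: algebra_simps)
  then have "norm (x - y) = t * norm (U y - U x)" using \<open>0 \<le> t\<close> by simp
  also have "\<dots> \<le> t * (L * norm (x - y))"
    using lip[of y x] \<open>0 \<le> t\<close> by (intro mult_left_mono) (auto simp: norm_minus_commute)
  finally have "(1 - t * L) * norm (x - y) \<le> 0" by (simp add: algebra_simps)
  then have "norm (x - y) \<le> 0" using \<open>t * L < 1\<close> by (simp add: mult_le_0_iff)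
  then show "x = y" by simp
qed

text \<open>Off \<open>B\<close> the map is the identity, so injectivity forbids a point of
  \<open>B\<close> to be sent outside. Conversely, Banach's fixed point theorem for
  \<open>y - t *\<^sub>R U x\<close> gives a preimage of each \<open>y\<close>; a preimage outside
  \<open>B\<close> would equal \<open>y\<close>.\<close>

lemma perturbation_of_id_image:
  fixes U :: "'a::banach \<Rightarrow> 'a"
  assumes lip: "\<And>x y. norm (U x - U y) \<le> L * norm (x - y)" and t: "0 \<le> t" "t * L < 1" "0 \<le> L"
    and zero: "\<And>x. x \<notin> B \<Longrightarrow> U x = 0"
  shows "(\<lambda>x. x + t *\<^sub>R U x) ` B = B"
proof -
  let ?\<Phi> = "\<lambda>x. x + t *\<^sub>R U x"
  have inj: "inj ?\<Phi>" by (rule inj_perturbation_of_id[OF lip t(1,2)])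
  have surj: "\<exists>x. ?\<Phi> x = y" for y
  proof -
    have "dist (y - t *\<^sub>R U x) (y - t *\<^sub>R U x') \<le> (t * L) * dist x x'" for x x'
    proof -
      have "dist (y - t *\<^sub>R U x) (y - t *\<^sub>R U x') = norm (t *\<^sub>R (U x - U x'))"
        by (simp add: dist_norm norm_minus_commute scaleR_diff_right)
      also have "\<dots> = t * norm (U x - U x')" using t by simp
      also have "\<dots> \<le> t * (L * norm (x - x'))" using lip t by (intro mult_left_mono) auto
      finally show ?thesis by (simp add: dist_norm mult.assoc)
    qed
    then obtain x where "y - t *\<^sub>R U x = x"
      using banach_fix_type[of "t * L" "\<lambda>x. y - t *\<^sub>R U x"] t by auto
    then show ?thesis by (intro exI[of _ x]) (simp add: algebra_simps)
  qed
  show ?thesis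
  proof (intro equalityI subsetI)
    fix y assume "y \<in> ?\<Phi> ` B"
    then obtain x where x: "x \<in> B" "y = ?\<Phi> x" by blast
    show "y \<in> B"
    proof (rule ccontr)
      assume "y \<notin> B"
      then have "?\<Phi> y = ?\<Phi> x" using zero x by simp
      then have "y = x" by (rule injD[OF inj])
      then show False using x(1) \<open>y \<notin> B\<close> by simp
    qed
  next
    fix y assume "y \<in> B"
    obtain x where x: "?\<Phi> x = y" using surj by blast
    have "x \<in> B"
    proof (rule ccontr)
      assume "x \<notin> B"
      then have "x = y" using zero[of x] x by simp
      then show False using \<open>x \<notin> B\<close> \<open>y \<in> B\<close> by simp
    qed
    then show "y \<in> ?\<Phi> ` B" using x by (intro image_eqI[of y ?\<Phi> x]) auto
  qed
qed

text \<open>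
  For small \<open>t\<close> the map \<open>x + t U x\<close> permutes the box, so the integral of its Jacobian determinant
  \<open>1 + t tr J + t\<^sup>2 det J\<close> does not depend on \<open>t\<close>; hence the coefficient of \<open>t\<^sup>2\<close> vanishes.
  This avoids the second derivatives of an integration by parts.
\<close>

lemma integral_det_jacobian_eq_0:
  assumes U: "C1_supported_in S U J" and S: "S \<subseteq> cbox a b"
  shows "integral (cbox a b) (\<lambda>x. det (J x)) = 0"
proof -
  let ?B = "cbox a b"
  have der: "(U has_derivative (\<lambda>h. J x *v h)) (at x within X)" for x X
    using U unfolding C1_supported_in_def by (blast intro: has_derivative_at_withinI)
  have cont: "continuous_on UNIV J" using U unfolding C1_supported_in_def by blast
  have zero: "U x = 0" if "x \<notin> ?B" for x
    using U S that unfolding C1_supported_in_def by blast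
  obtain C where C: "C > 0" "\<And>x i j. \<bar>J x $ i $ j\<bar> \<le> C"
    using C1_supported_in_bounded_jacobian[OF U] by blast
  \<comment> \<open>An entrywise bound \<open>C\<close> on a 2 by 2 matrix bounds its operator norm
    by \<open>2 * 2 * C\<close>.\<close>
  have lip: "norm (U x - U y) \<le> (4 * C) * norm (x - y)" for x y
    using onorm_le_matrix_component[of "J _" C] C(2)
    by (intro differentiable_bound[of UNIV U "\<lambda>x h. J x *v h"]) (auto intro: der)
  have tr_le: "\<bar>trace (J x)\<bar> \<le> 2 * C" for x
    using C(2)[of x 1 1] C(2)[of x 2 2] by (simp add: trace_def sum_2)
  have det_le: "\<bar>det (J x)\<bar> \<le> 2 * C\<^sup>2" for x
  proof -
    have "\<bar>J x $ 1 $ 1 * J x $ 2 $ 2\<bar> \<le> C * C" "\<bar>J x $ 1 $ 2 * J x $ 2 $ 1\<bar> \<le> C * C"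
      using C by (auto simp: abs_mult intro!: mult_mono)
    then show ?thesis by (simp add: det_2 power2_eq_square)
  qed
  have cont_tr: "continuous_on X (\<lambda>x. trace (J x))" and cont_det: "continuous_on X (\<lambda>x. det (J x))" for X
    unfolding trace_def sum_2 det_2
    by (auto intro!: continuous_intros continuous_on_subset[OF cont])
  define I1 I2 where "I1 = integral ?B (\<lambda>x. trace (J x))" and "I2 = integral ?B (\<lambda>x. det (J x))"
  have key: "t * I1 + t\<^sup>2 * I2 = 0" if t: "0 < t" "t * (4 * C) < 1" for t
  proof -
    let ?\<Phi> = "\<lambda>x. x + t *\<^sub>R U x"
    let ?D = "\<lambda>x h. (mat 1 + t *\<^sub>R J x) *v h"
    have derPhi: "(?\<Phi> has_derivative ?D x) (at x within ?B)" for x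
    proof -
      have "(?\<Phi> has_derivative (\<lambda>h. h + t *\<^sub>R (J x *v h))) (at x within ?B)"
        by (auto intro!: derivative_eq_intros der)
      moreover have "(\<lambda>h. h + t *\<^sub>R (J x *v h)) = ?D x"
        by (simp add: matrix_vector_mult_add_rdistrib scaleR_matrix_vector_assoc)
      ultimately show ?thesis by simp
    qed
    \<comment> \<open>As \<open>t * C < 1/4\<close>, the trace term is at least \<open>- 1/2\<close>
      and the determinant term at least \<open>- 1/8\<close>. The determinant is therefore positive
      and the absolute value disappears.\<close>
    have det_eq: "\<bar>det (matrix (?D x))\<bar> = 1 + t * trace (J x) + t\<^sup>2 * det (J x)" for x
    proof -
      have "t * \<bar>trace (J x)\<bar> \<le> t * (2 * C)" "t\<^sup>2 * \<bar>det (J x)\<bar> \<le> t\<^sup>2 * (2 * C\<^sup>2)"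
        using tr_le det_le t by (auto intro!: mult_left_mono simp del: mult_le_cancel_left_pos)
      moreover have "t\<^sup>2 * (2 * C\<^sup>2) = 2 * (t * C) * (t * C)" by (simp add: power2_eq_square)
      moreover have "2 * (t * C) * (t * C) \<le> 2 * (1/4) * (1/4)"
        using t C by (intro mult_mono) auto
      moreover have "t * (2 * C) \<le> 1/2" using t by simp
      moreover have "- (t * trace (J x)) \<le> t * \<bar>trace (J x)\<bar>" "- (t\<^sup>2 * det (J x)) \<le> t\<^sup>2 * \<bar>det (J x)\<bar>"
        using t by (metis abs_ge_minus_self abs_mult abs_of_pos zero_less_power)+
      ultimately have "0 \<le> 1 + t * trace (J x) + t\<^sup>2 * det (J x)" by linarith
      then show ?thesis by (simp add: det_id_plus_scaleR_2 matrix_of_matrix_vector_mul)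
    qed
    have int: "(\<lambda>x. trace (J x)) integrable_on ?B" "(\<lambda>x. det (J x)) integrable_on ?B"
      by (auto intro!: integrable_continuous cont_tr cont_det)
    have "measure lebesgue (?\<Phi> ` ?B) = integral ?B (\<lambda>x. \<bar>det (matrix (?D x))\<bar>)"
    proof (rule measure_differentiable_image_eq)
      show "inj_on ?\<Phi> ?B"
        using inj_perturbation_of_id[OF lip, of t] t by (auto intro: inj_on_subset)
      show "(\<lambda>x. \<bar>det (matrix (?D x))\<bar>) integrable_on ?B"
        unfolding det_eq by (intro integrable_add integrable_on_mult_right int) auto
    qed (auto intro: derPhi)
    also have "?\<Phi> ` ?B = ?B"
      using perturbation_of_id_image[OF lip, of t ?B] t C zero by auto
    also have "integral ?B (\<lambda>x. \<bar>det (matrix (?D x))\<bar>) = integral ?B (\<lambda>x. 1) + t * I1 + t\<^sup>2 * I2"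
      unfolding det_eq I1_def I2_def
      by (intro integral_unique has_integral_add has_integral_mult_right integrable_integral int
          integrable_on_const) auto
    also have "integral ?B (\<lambda>x. 1) = measure lebesgue ?B"
      by (rule lmeasure_integral[symmetric]) simp
    finally show ?thesis by simp
  qed
  \<comment> \<open>Both \<open>t\<close> and \<open>t/2\<close> are admissible in
    \<open>key\<close>; comparing the two identities eliminates \<open>I1\<close>.\<close>
  define t where "t = 1 / (8 * C)"
  have "t > 0" "t * (4 * C) < 1" "t/2 * (4 * C) < 1" using C(1) by (auto simp: t_def field_simps)
  then have "t * I1 + t\<^sup>2 * I2 = 0" "t/2 * I1 + (t/2)\<^sup>2 * I2 = 0" using key[of t] key[of "t/2"] by auto
  then have "t * I1 + t\<^sup>2 * I2 = 0" "t * I1 / 2 + t\<^sup>2 * I2 / 4 = 0" by (simp_all add: power_divide)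
  then have "t\<^sup>2 * I2 = 0" by linarith
  then show ?thesis using \<open>t > 0\<close> by (simp add: I2_def)
qed

section \<open>Power fields and the elasticity form\<close>

definition outer_product :: "real^'m \<Rightarrow> real^'n \<Rightarrow> real^'n^'m" where
  "outer_product a b = (\<chi> i j. a $ i * b $ j)"

lemma outer_product_mult_vec: "outer_product a b *v h = (b \<bullet> h) *\<^sub>R a"
  by (simp add: outer_product_def vec_eq_iff matrix_vector_mult_def inner_vec_def
      sum_distrib_left sum_distrib_right mult_ac)

lemma continuous_on_outer_product [continuous_intros]:
  fixes a :: "'a::topological_space \<Rightarrow> real^'m" and b :: "'a \<Rightarrow> real^'n"
  assumes "continuous_on S a" "continuous_on S b"
  shows "continuous_on S (\<lambda>x. outer_product (a x) (b x))"
  unfolding outer_product_def by (intro continuous_intros assms)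

text \<open>
  \<open>abs_powr r y\<close> is \<open>|y|\<^sup>r\<close> with \<open>|0|\<^sup>0 = 1\<close>, whereas \<open>0 powr 0 = 0\<close>; this makes it continuous
  for all \<open>r \<ge> 0\<close>.
\<close>

definition abs_powr :: "real \<Rightarrow> 'a::real_normed_vector \<Rightarrow> real" where
  "abs_powr r y = (if r = 0 then 1 else norm y powr r)"

text \<open>Since \<open>sgn 0 = 0\<close>, the value at the origin is \<open>mat 1\<close> for
  \<open>r = 0\<close> and \<open>0\<close> for \<open>r > 0\<close>, the correct derivative of
  \<open>|y|^r y\<close> in either case.\<close>

definition powr_field_jacobian :: "real \<Rightarrow> real^'n \<Rightarrow> real^'n^'n" where
  "powr_field_jacobian r y =
    abs_powr r y *\<^sub>R (mat 1 + r *\<^sub>R outer_product (sgn y) (sgn y))"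

lemma powr_field_jacobian_mult_vec:
  "powr_field_jacobian r y *v h = abs_powr r y *\<^sub>R (h + (r * (sgn y \<bullet> h)) *\<^sub>R sgn y)"
  by (simp add: powr_field_jacobian_def scaleR_matrix_vector_assoc[symmetric]
      matrix_vector_mult_add_rdistrib outer_product_mult_vec)

text \<open>Away from the origin this is the product rule. At the origin, for \<open>r > 0\<close>,
  the difference quotient has norm \<open>|h|^r\<close>, which tends to \<open>0\<close>. For
  \<open>r = 0\<close> the convention \<open>0 powr 0 = 0\<close> is harmless, as it multiplies the
  zero vector.\<close>

lemma has_derivative_powr_field:
  fixes y :: "real^'n"
  assumes "0 \<le> r"
  shows "((\<lambda>y. (norm y powr r) *\<^sub>R y) has_derivative (\<lambda>h. powr_field_jacobian r y *v h)) (at y)"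
proof (cases "r = 0")
  case True
  have "(\<lambda>y::real^'n. (norm y powr 0) *\<^sub>R y) = (\<lambda>y. y)" by (auto simp: fun_eq_iff)
  then show ?thesis using True
    by (simp add: powr_field_jacobian_mult_vec abs_powr_def)
next
  case False
  then have r: "r > 0" using assms by simp
  show ?thesis
  proof (cases "y = 0")
    case True
    have lim: "((\<lambda>h::real^'n. norm h powr r) \<longlongrightarrow> 0) (at 0)"
      using r by (auto intro!: tendsto_eq_intros)
    have "((\<lambda>h::real^'n. norm ((norm h powr r) *\<^sub>R h) / norm h) \<longlongrightarrow> 0) (at 0)"
      by (rule Lim_transform_eventually[OF lim]) (auto simp: eventually_at_filter)
    then have "((\<lambda>y. (norm y powr r) *\<^sub>R y) has_derivative (\<lambda>h. 0)) (at (0::real^'n))"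
      by (simp add: has_derivative_at)
    then show ?thesis
      using True r by (simp add: powr_field_jacobian_mult_vec abs_powr_def)
  next
    case False
    have n: "norm y > 0" using False by simp
    have "((\<lambda>y. norm y powr r) has_derivative
        (\<lambda>h. norm y powr r * (0 * ln (norm y) + (h \<bullet> sgn y) * r / norm y))) (at y)"
      by (rule has_derivative_powr[OF has_derivative_norm[OF False] has_derivative_const n]) simp
    from has_derivative_scaleR[OF this has_derivative_ident]
    have "((\<lambda>y. (norm y powr r) *\<^sub>R y) has_derivative
        (\<lambda>h. (norm y powr r) *\<^sub>R h + (norm y powr r * ((h \<bullet> sgn y) * r / norm y)) *\<^sub>R y)) (at y)"
      by simp
    moreover have "y = norm y *\<^sub>R sgn y" using False by (simp add: sgn_div_norm)
    then have "(norm y powr r) *\<^sub>R h + (norm y powr r * ((h \<bullet> sgn y) * r / norm y)) *\<^sub>R y =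
        powr_field_jacobian r y *v h" for h
      using r n by (simp add: powr_field_jacobian_mult_vec abs_powr_def sgn_div_norm inner_commute
          field_simps)
    ultimately show ?thesis by simp
  qed
qed

lemma continuous_on_abs_powr:
  "0 \<le> r \<Longrightarrow> continuous_on S (abs_powr r :: 'a::real_normed_vector \<Rightarrow> real)"
  by (cases "r = 0")
    (auto simp: abs_powr_def[abs_def] intro!: continuous_on_powr' continuous_on_norm_id continuous_on_const)

lemma abs_sgn_component_le_1: "\<bar>sgn (y :: real^'n) $ i\<bar> \<le> 1"
  using component_le_norm_cart[of "sgn y" i] by (cases "y = 0") (auto simp: norm_sgn)

text \<open>Only the origin is critical: \<open>sgn\<close> jumps there, but its components are
  bounded and the factor \<open>|y|^r\<close> tends to \<open>0\<close>. For \<open>r = 0\<close>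
  the Jacobian is constant.\<close>

lemma continuous_powr_field_jacobian:
  assumes "0 \<le> r"
  shows "continuous_on S (powr_field_jacobian r :: real^'n \<Rightarrow> real^'n^'n)"
proof (cases "r = 0")
  case True
  then have "powr_field_jacobian r = (\<lambda>_::real^'n. mat 1)"
    by (simp add: powr_field_jacobian_def fun_eq_iff abs_powr_def)
  then show ?thesis by simp
next
  case False
  then have r: "r > 0" using assms by simp
  have "isCont (\<lambda>y::real^'n. norm y powr r * (sgn y $ i * sgn y $ j)) y" for y i j
  proof (cases "y = 0")
    case True
    have lim: "((\<lambda>h::real^'n. norm h powr r) \<longlongrightarrow> 0) (at 0)"
      using r by (auto intro!: tendsto_eq_intros)
    have "norm (norm h powr r * (sgn h $ i * sgn h $ j)) \<le> norm h powr r" for h :: "real^'n"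
    proof -
      have "\<bar>sgn h $ i\<bar> * \<bar>sgn h $ j\<bar> \<le> 1 * 1"
        using abs_sgn_component_le_1 by (intro mult_mono) auto
      then have "norm h powr r * (\<bar>sgn h $ i\<bar> * \<bar>sgn h $ j\<bar>) \<le> norm h powr r * (1 * 1)"
        by (rule mult_left_mono) simp
      then show ?thesis by (simp add: abs_mult)
    qed
    then have "((\<lambda>y::real^'n. norm y powr r * (sgn y $ i * sgn y $ j)) \<longlongrightarrow> 0) (at 0)"
      by (intro Lim_null_comparison[OF _ lim] always_eventually) blast
    then show ?thesis using True r by (simp add: isCont_def)
  next
    case False
    then show ?thesis
      by (intro continuous_intros) auto
  qed
  then have *: "continuous_on S (\<lambda>y::real^'n. norm y powr r * (sgn y $ i * sgn y $ j))" for i j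
    by (simp add: continuous_at_imp_continuous_on)
  have "powr_field_jacobian r = (\<lambda>y::real^'n. (norm y powr r) *\<^sub>R mat 1 +
      r *\<^sub>R (\<chi> i j. norm y powr r * (sgn y $ i * sgn y $ j)))"
    using r by (simp add: fun_eq_iff powr_field_jacobian_def abs_powr_def outer_product_def vec_eq_iff algebra_simps)
  moreover have "continuous_on S (\<lambda>y::real^'n. norm y powr r)"
    using r by (intro continuous_on_powr' continuous_intros) auto
  ultimately show ?thesis
    using * by (simp only:)
      (intro continuous_on_add continuous_on_scaleR continuous_on_const continuous_on_vec_lambda)
qed

lemma continuous_on_matrix_mult [continuous_intros]:
  fixes A :: "'a::topological_space \<Rightarrow> real^'n^'m" and B :: "'a \<Rightarrow> real^'k^'n"
  assumes "continuous_on S A" "continuous_on S B"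
  shows "continuous_on S (\<lambda>x. A x ** B x)"
  unfolding matrix_matrix_mult_def by (intro continuous_intros assms)

text \<open>The chain rule. It serves twice: with exponent \<open>r\<close> for the second argument
  of the form, and with \<open>r / 2\<close> for the field whose determinant is the null
  Lagrangian.\<close>

lemma C1_supported_in_powr_field:
  assumes "0 \<le> r" and U: "C1_supported_in S U J"
  shows "C1_supported_in S (\<lambda>x. (norm (U x) powr r) *\<^sub>R U x) (\<lambda>x. powr_field_jacobian r (U x) ** J x)"
proof -
  have der: "(U has_derivative (\<lambda>h. J x *v h)) (at x)" for x
    using U unfolding C1_supported_in_def by blast
  have "((\<lambda>x. (norm (U x) powr r) *\<^sub>R U x) has_derivative
      (\<lambda>h. (powr_field_jacobian r (U x) ** J x) *v h)) (at x)" for x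
    using diff_chain_at[OF der[of x] has_derivative_powr_field[OF \<open>0 \<le> r\<close>, of "U x"]]
    by (simp add: o_def matrix_vector_mul_assoc)
  moreover have "continuous_on UNIV U"
    using der by (meson continuous_at_imp_continuous_on has_derivative_continuous)
  then have "continuous_on UNIV (\<lambda>x. powr_field_jacobian r (U x))"
    using continuous_on_compose[of UNIV U "powr_field_jacobian r"]
      continuous_powr_field_jacobian[OF \<open>0 \<le> r\<close>, of "range U"] by (simp add: o_def)
  ultimately show ?thesis
    using U by (simp add: C1_supported_in_def continuous_on_matrix_mult)
qed

text \<open>The integrand of \<open>elasticity_form\<close> as a bilinear form in two Jacobian
  matrices, with \<open>\<gamma>\<close> standing for \<open>inverse (1 - 2 * \<nu>)\<close>. It
  separates the matrix algebra from the integration.\<close>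

definition elasticity_density :: "real \<Rightarrow> real^2^2 \<Rightarrow> real^2^2 \<Rightarrow> real" where
  "elasticity_density \<gamma> A B = (\<Sum>j\<in>UNIV. A $ j \<bullet> B $ j) + \<gamma> * (trace A * trace B)"

lemma continuous_on_elasticity_density [continuous_intros]:
  fixes A B :: "'a::topological_space \<Rightarrow> real^2^2"
  assumes "continuous_on S A" "continuous_on S B"
  shows "continuous_on S (\<lambda>x. elasticity_density \<gamma> (A x) (B x))"
  unfolding elasticity_density_def trace_def by (intro continuous_intros assms)

section \<open>Fields on \<open>\<Omega>\<close>, their extension by zero, and the form as an
  integral over a box\<close>

lemma has_derivative_matrix_imp_jacobian:
  fixes f :: "real^'n \<Rightarrow> real^'m"
  assumes "(f has_derivative (\<lambda>h. A *v h)) (at x)"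
  shows "jacobian f (at x) = A"
  unfolding jacobian_def frechet_derivative_at[OF assms, symmetric]
  by (rule matrix_of_matrix_vector_mul)

lemma has_derivative_transfer_open:
  fixes U :: "real^'n \<Rightarrow> real^'m"
  assumes "open \<Omega>" "x \<in> \<Omega>" "\<And>y. y \<in> \<Omega> \<Longrightarrow> u y = U y" "(U has_derivative D) (at x)"
  shows "(u has_derivative D) (at x)"
  using assms has_derivative_transform_within_open[of U D x UNIV \<Omega> u] by simp

lemma C1_supported_in_imp_C1_compact_support:
  assumes \<Omega>: "open \<Omega>" "S \<subseteq> \<Omega>" and U: "C1_supported_in S U J"
  shows "U \<in> C1_compact_support \<Omega>"
proof -
  have S: "compact S" and cont: "continuous_on UNIV J"
    and der: "(U has_derivative (\<lambda>h. J x *v h)) (at x)" and zero: "x \<notin> S \<Longrightarrow> U x = 0" for x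
    using U unfolding C1_supported_in_def by blast+
  have "U differentiable_on \<Omega>"
    using der by (meson differentiable_at_imp_differentiable_on differentiable_def)
  moreover have "(\<lambda>x. jacobian U (at x)) = J"
    using has_derivative_matrix_imp_jacobian[OF der] by blast
  moreover have "closure {x\<in>\<Omega>. U x \<noteq> 0} \<subseteq> S"
    using zero S by (intro closure_minimal) (auto simp: compact_imp_closed)
  moreover have "compact (closure {x\<in>\<Omega>. U x \<noteq> 0})"
    using calculation(3) S by (meson bounded_closure_image bounded_subset closed_closure
        compact_eq_bounded_closed)
  ultimately show ?thesis
    using \<Omega> cont by (auto simp: C1_compact_support_def intro: continuous_on_subset)
qed

text \<open>Extension by zero. The open sets \<open>\<Omega>\<close> and \<open>- S\<close> cover
  the plane; the field is \<open>u\<close> on the first and \<open>0\<close> on the second, and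
  uniqueness of the derivative makes the two Jacobians agree on the overlap.\<close>

lemma C1_compact_support_extend:
  assumes \<Omega>: "open \<Omega>" and u: "u \<in> C1_compact_support \<Omega>"
  obtains S U J where "C1_supported_in S U J" "S \<subseteq> \<Omega>" "\<And>x. x \<in> \<Omega> \<Longrightarrow> u x = U x"
proof -
  define S where "S = closure {x\<in>\<Omega>. u x \<noteq> 0}"
  define U where "U = (\<lambda>x. if x \<in> \<Omega> then u x else 0)"
  define J where "J = (\<lambda>x. if x \<in> \<Omega> then jacobian u (at x) else 0)"
  have S: "compact S" "S \<subseteq> \<Omega>"
    and diff: "u differentiable_on \<Omega>" and cont: "continuous_on \<Omega> (\<lambda>x. jacobian u (at x))"
    using u by (auto simp: C1_compact_support_def S_def)
  have zero: "U x = 0" if "x \<notin> S" for x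
    using that closure_subset[of "{x\<in>\<Omega>. u x \<noteq> 0}"] by (auto simp: U_def S_def)
  have opn: "open (- S)" using S(1) by (simp add: compact_imp_closed open_Compl)
  have der_out: "(U has_derivative (\<lambda>h. 0 *v h)) (at x)" if "x \<notin> S" for x
    by (rule has_derivative_transfer_open[OF opn, where U = "\<lambda>_. 0"]) (use that zero in auto)
  have der_in: "(U has_derivative (\<lambda>h. J x *v h)) (at x)" if "x \<in> \<Omega>" for x
  proof -
    have "u differentiable (at x)" using diff \<Omega> that by (metis differentiable_on_eq_differentiable_at)
    then have du: "(u has_derivative (\<lambda>h. J x *v h)) (at x)"
      using that unfolding J_def by (simp add: jacobian_works)
    show ?thesis
      by (rule has_derivative_transfer_open[where \<Omega> = \<Omega> and u = U and U = u])
        (use \<Omega> that du in \<open>simp_all add: U_def\<close>)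
  qed
  have J0: "J x = 0" if "x \<notin> S" for x
  proof (cases "x \<in> \<Omega>")
    case True
    show ?thesis by (rule has_derivative_matrix_unique[OF der_in[OF True] der_out[OF that]])
  qed (simp add: J_def)
  have "(U has_derivative (\<lambda>h. J x *v h)) (at x)" for x
  proof (cases "x \<in> S")
    case True
    then show ?thesis using der_in S(2) by blast
  next
    case False
    show ?thesis using der_out[OF False] unfolding J0[OF False] .
  qed
  moreover have "continuous_on UNIV J"
  proof -
    have "continuous_on \<Omega> J" using cont by (rule continuous_on_eq) (simp add: J_def)
    moreover have "continuous_on (- S) J"
      using J0 by (intro continuous_on_eq[OF continuous_on_const[of _ 0]]) auto
    ultimately have "continuous_on (\<Omega> \<union> - S) J"
      using \<Omega> opn by (intro continuous_on_open_Un)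
    moreover have "\<Omega> \<union> - S = UNIV" using S(2) by blast
    ultimately show ?thesis by simp
  qed
  ultimately have "C1_supported_in S U J"
    using S zero by (auto simp: C1_supported_in_def)
  then show thesis using S(2) that[of S U J] by (auto simp: U_def)
qed

text \<open>The integrand vanishes off \<open>S\<close>, so \<open>\<Omega>\<close> may be exchanged
  for any box containing \<open>S\<close>. There it is continuous, and the Lebesgue and gauge
  integrals coincide.\<close>

lemma elasticity_form_eq_integral:
  assumes \<Omega>: "open \<Omega>" "S \<subseteq> \<Omega>" "S \<subseteq> cbox a b"
    and U: "C1_supported_in S U J" and V: "C1_supported_in S V K"
    and eq: "\<And>x. x \<in> \<Omega> \<Longrightarrow> u x = U x" "\<And>x. x \<in> \<Omega> \<Longrightarrow> v x = V x"
  shows "elasticity_form \<nu> \<Omega> u v =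
    integral (cbox a b) (\<lambda>x. elasticity_density (inverse (1 - 2 * \<nu>)) (J x) (K x))"
proof -
  let ?F = "\<lambda>x. elasticity_density (inverse (1 - 2 * \<nu>)) (J x) (K x)"
  have J: "jacobian u (at x) = J x" and K: "jacobian v (at x) = K x" if "x \<in> \<Omega>" for x
    using U V has_derivative_transfer_open[of \<Omega> x u U, OF \<Omega>(1) that eq(1)]
      has_derivative_transfer_open[of \<Omega> x v V, OF \<Omega>(1) that eq(2)]
    by (simp_all add: C1_supported_in_def has_derivative_matrix_imp_jacobian)
  have F0: "?F x = 0" if "x \<notin> S" for x
    using C1_supported_in_jacobian_eq_0[OF U that] by (simp add: elasticity_density_def trace_def)
  have "elasticity_form \<nu> \<Omega> u v = (LINT x:\<Omega>|lborel. ?F x)"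
    unfolding elasticity_form_def set_lebesgue_integral_def
    by (intro Bochner_Integration.integral_cong refl)
      (auto simp: indicator_def grad_comp_def divergence_def elasticity_density_def J K)
  also have "\<dots> = (LINT x:cbox a b|lborel. ?F x)"
    unfolding set_lebesgue_integral_def
    using \<Omega> F0 by (intro Bochner_Integration.integral_cong refl) (auto simp: indicator_def)
  also have "\<dots> = integral (cbox a b) ?F"
  proof (rule set_borel_integral_eq_integral(2))
    have "continuous_on UNIV J" "continuous_on UNIV K"
      using U V by (auto simp: C1_supported_in_def)
    then have "continuous_on (cbox a b) ?F"
      by (intro continuous_on_elasticity_density) (auto intro: continuous_on_subset)
    then show "set_integrable lborel (cbox a b) ?F"
      unfolding set_integrable_def by (intro borel_integrable_compact) auto
  qed
  finally show ?thesis .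
qed

section \<open>Sufficiency\<close>

lemma elasticity_density_scaleR_right:
  "elasticity_density \<gamma> A (c *\<^sub>R B) = c * elasticity_density \<gamma> A B"
  by (simp add: elasticity_density_def trace_def sum_2 algebra_simps)

lemma det_scaleR_2: "det (c *\<^sub>R A) = c\<^sup>2 * det A" for A :: "real^2^2"
  by (simp add: det_2 algebra_simps power2_eq_square)

lemma scaleR_matrix_mult_left:
  fixes A :: "real^'n^'m" and B :: "real^'k^'n"
  shows "(c *\<^sub>R A) ** B = c *\<^sub>R (A ** B)"
  by (simp add: matrix_matrix_mult_def vec_eq_iff sum_distrib_left mult.assoc)

text \<open>
  \<open>a, b, c, d\<close> are the entries of \<open>M\<close> in the orthonormal basis consisting of \<open>w\<close> and its rotation
  by a right angle.
\<close>

lemma orthonormal_frame_entries: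
  fixes M :: "real^2^2" and w :: "real^2"
  assumes "norm w = 1"
  obtains a b c d where "det M = a * d - b * c"
    and "\<And>r \<gamma>. elasticity_density \<gamma> M ((mat 1 + r *\<^sub>R outer_product w w) ** M) =
      (1 + r) * (a\<^sup>2 + b\<^sup>2) + c\<^sup>2 + d\<^sup>2 + \<gamma> * (a + d) * ((1 + r) * a + d)"
proof -
  define w1 w2 where "w1 = w $ 1" and "w2 = w $ 2"
  have w: "w1\<^sup>2 + w2\<^sup>2 = 1"
    using assms by (simp add: w1_def w2_def norm_eq_sqrt_inner inner_vec_def sum_2 power2_eq_square)
  define m11 m12 m21 m22 where "m11 = M$1$1" "m12 = M$1$2" "m21 = M$2$1" "m22 = M$2$2"
  note m = m11_m12_m21_m22_def
  \<comment> \<open>\<open>(p, q)\<close> and \<open>(p', q')\<close> are the rows of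
    \<open>M\<close> after multiplication from the left by \<open>w\<close> and by \<open>w\<close>
    turned by a right angle; \<open>a, b\<close> and \<open>c, d\<close> result from the same
    rotation applied from the right.\<close>
  define p q p' q' where "p = w1 * m11 + w2 * m21" "q = w1 * m12 + w2 * m22"
    "p' = w1 * m21 - w2 * m11" "q' = w1 * m22 - w2 * m12"
  note pq = p_q_p'_q'_def
  define a b c d where "a = p * w1 + q * w2" "b = q * w1 - p * w2"
    "c = p' * w1 + q' * w2" "d = q' * w1 - p' * w2"
  note abcd = a_b_c_d_def
  \<comment> \<open>Each identity up to \<open>det\<close> holds as a polynomial identity once
    powers of \<open>w1\<^sup>2 + w2\<^sup>2\<close>, which is \<open>1\<close>, are
    inserted.\<close>
  have tr: "a + d = m11 + m22"
  proof -
    have "a + d = (w1\<^sup>2 + w2\<^sup>2) * (m11 + m22)"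
      unfolding abcd pq by (simp add: algebra_simps power2_eq_square)
    then show ?thesis using w by simp
  qed
  have ab: "a\<^sup>2 + b\<^sup>2 = p\<^sup>2 + q\<^sup>2"
  proof -
    have "a\<^sup>2 + b\<^sup>2 = (w1\<^sup>2 + w2\<^sup>2) * (p\<^sup>2 + q\<^sup>2)"
      unfolding abcd by (simp add: algebra_simps power2_eq_square)
    then show ?thesis using w by simp
  qed
  have cd: "c\<^sup>2 + d\<^sup>2 = p'\<^sup>2 + q'\<^sup>2"
  proof -
    have "c\<^sup>2 + d\<^sup>2 = (w1\<^sup>2 + w2\<^sup>2) * (p'\<^sup>2 + q'\<^sup>2)"
      unfolding abcd by (simp add: algebra_simps power2_eq_square)
    then show ?thesis using w by simp
  qed
  have nrm: "p\<^sup>2 + q\<^sup>2 + p'\<^sup>2 + q'\<^sup>2 = m11\<^sup>2 + m12\<^sup>2 + m21\<^sup>2 + m22\<^sup>2"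
  proof -
    have "p\<^sup>2 + q\<^sup>2 + p'\<^sup>2 + q'\<^sup>2 = (w1\<^sup>2 + w2\<^sup>2) * (m11\<^sup>2 + m12\<^sup>2 + m21\<^sup>2 + m22\<^sup>2)"
      unfolding pq by (simp add: algebra_simps power2_eq_square)
    then show ?thesis using w by simp
  qed
  have det: "a * d - b * c = m11 * m22 - m12 * m21"
  proof -
    have "a * d - b * c = (w1\<^sup>2 + w2\<^sup>2) * (p * q' - q * p')"
      unfolding abcd by (simp add: algebra_simps power2_eq_square)
    also have "p * q' - q * p' = (w1\<^sup>2 + w2\<^sup>2) * (m11 * m22 - m12 * m21)"
      unfolding pq by (simp add: algebra_simps power2_eq_square)
    finally show ?thesis using w by simp
  qed
  show thesis
  proof
    show "det M = a * d - b * c" using det by (simp add: det_2 m)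
  next
    fix r \<gamma>
    \<comment> \<open>The rank-one term contributes \<open>r * (p\<^sup>2 + q\<^sup>2)\<close> to
      the inner product of the matrices and \<open>r * a\<close> to the trace.\<close>
    have "elasticity_density \<gamma> M ((mat 1 + r *\<^sub>R outer_product w w) ** M) =
        (m11\<^sup>2 + m12\<^sup>2 + m21\<^sup>2 + m22\<^sup>2) + r * (p\<^sup>2 + q\<^sup>2) + \<gamma> * (m11 + m22) * (m11 + m22 + r * a)"
      unfolding abcd pq w1_def w2_def m
      by (simp add: elasticity_density_def trace_def sum_2 inner_vec_def matrix_matrix_mult_def mat_def outer_product_def
          algebra_simps power2_eq_square)
    also have "\<dots> = (a\<^sup>2 + b\<^sup>2 + (c\<^sup>2 + d\<^sup>2)) + r * (a\<^sup>2 + b\<^sup>2) + \<gamma> * (a + d) * (a + d + r * a)"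
      unfolding tr ab cd nrm[symmetric] by simp
    also have "\<dots> = (1 + r) * (a\<^sup>2 + b\<^sup>2) + c\<^sup>2 + d\<^sup>2 + \<gamma> * (a + d) * ((1 + r) * a + d)"
      by (simp add: algebra_simps)
    finally show "elasticity_density \<gamma> M ((mat 1 + r *\<^sub>R outer_product w w) ** M) =
      (1 + r) * (a\<^sup>2 + b\<^sup>2) + c\<^sup>2 + d\<^sup>2 + \<gamma> * (a + d) * ((1 + r) * a + d)" .
  qed
qed

text \<open>The eigenvalues are \<open>1 + r\<close> along \<open>w\<close> and \<open>1\<close>
  across it.\<close>

lemma det_id_plus_outer_product:
  fixes w :: "real^2"
  assumes "norm w = 1"
  shows "det (mat 1 + r *\<^sub>R outer_product w w) = 1 + r"
proof -
  have "(w$1)\<^sup>2 + (w$2)\<^sup>2 = 1"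
    using assms by (simp add: norm_eq_sqrt_inner inner_vec_def sum_2 power2_eq_square)
  moreover have "det (mat 1 + r *\<^sub>R outer_product w w) = 1 + r * ((w$1)\<^sup>2 + (w$2)\<^sup>2)"
    by (simp add: det_2 mat_def outer_product_def algebra_simps power2_eq_square)
  ultimately show ?thesis by simp
qed

text \<open>The form splits into one in \<open>b, c\<close>, nonnegative if
  \<open>\<bar>T\<bar> \<le> sqrt q\<close>, and one in \<open>a, d\<close>, nonnegative if
  \<open>\<bar>k + T\<bar> \<le> (1 + \<gamma>) * sqrt q\<close> with
  \<open>k = \<gamma> * (q + 1) / 2\<close>. The two intervals for \<open>T\<close> meet because
  \<open>crit\<close> says \<open>\<bar>k\<bar> \<le> (2 + \<gamma>) * sqrt q\<close>.\<close>

lemma exists_null_lagrangian_multiplier: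
  fixes q \<gamma> :: real
  assumes q: "q > 0" and crit: "\<bar>\<gamma>\<bar> * (q + 1) \<le> 2 * (2 + \<gamma>) * sqrt q"
  shows "\<exists>T. \<forall>a b c d. 0 \<le> q * (a\<^sup>2 + b\<^sup>2) + c\<^sup>2 + d\<^sup>2 + \<gamma> * (a + d) * (q * a + d) + 2 * T * (a * d - b * c)"
proof -
  define s where "s = sqrt q"
  have s: "s > 0" "q = s\<^sup>2" using q by (auto simp: s_def)
  \<comment> \<open>The inequality of means turns \<open>crit\<close> into
    \<open>\<bar>\<gamma>\<bar> \<le> 2 + \<gamma>\<close>, whence \<open>1 + \<gamma>\<close> is
    nonnegative and the second interval is nonempty.\<close>
  have "0 \<le> (s - 1)\<^sup>2" by simp
  then have "2 * s \<le> q + 1" unfolding s(2) by (simp add: power2_eq_square algebra_simps)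
  then have "\<bar>\<gamma>\<bar> * (2 * s) \<le> 2 * (2 + \<gamma>) * s"
    using crit mult_left_mono[of "2 * s" "q + 1" "\<bar>\<gamma>\<bar>"] by (simp add: s_def)
  then have "\<bar>\<gamma>\<bar> * (2 * s) \<le> (2 + \<gamma>) * (2 * s)" by (simp add: algebra_simps)
  then have "\<bar>\<gamma>\<bar> \<le> 2 + \<gamma>" using s(1) by (subst (asm) mult_le_cancel_right_pos) auto
  then have \<gamma>: "0 \<le> 1 + \<gamma>" by linarith
  define k where "k = \<gamma> * (q + 1) / 2"
  have k: "k \<le> (2 + \<gamma>) * s" "- ((2 + \<gamma>) * s) \<le> k"
  proof -
    have "\<bar>k\<bar> = \<bar>\<gamma>\<bar> * (q + 1) / 2" using q by (simp add: k_def abs_mult)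
    then have "\<bar>k\<bar> \<le> (2 + \<gamma>) * s" using crit unfolding s_def by linarith
    then show "k \<le> (2 + \<gamma>) * s" "- ((2 + \<gamma>) * s) \<le> k" by linarith+
  qed
  have gs: "0 \<le> (1 + \<gamma>) * s" "(2 + \<gamma>) * s = (1 + \<gamma>) * s + s"
    using mult_nonneg_nonneg[of "1 + \<gamma>" s] \<gamma> s(1) by (auto simp: algebra_simps)
  \<comment> \<open>The point of \<open>[- s, s]\<close> closest to \<open>- k\<close>.\<close>
  define T where "T = max (- s) (min s (- k))"
  have "\<bar>max (- s) (min s (- k))\<bar> \<le> s \<and> \<bar>k + max (- s) (min s (- k))\<bar> \<le> g"
    if "0 \<le> g" "k \<le> g + s" "- (g + s) \<le> k" for g
    using that s(1) by linarith
  then have T: "\<bar>T\<bar> \<le> s" "\<bar>k + T\<bar> \<le> (1 + \<gamma>) * s"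
    using k gs unfolding T_def by simp_all
  have "0 \<le> q * (a\<^sup>2 + b\<^sup>2) + c\<^sup>2 + d\<^sup>2 + \<gamma> * (a + d) * (q * a + d) + 2 * T * (a * d - b * c)" for a b c d
  proof -
    have "T\<^sup>2 \<le> q" using T(1) s by (metis abs_le_square_iff abs_of_pos)
    then have "0 \<le> (c - T * b)\<^sup>2 + (q - T\<^sup>2) * b\<^sup>2" by simp
    also have "\<dots> = q * b\<^sup>2 + c\<^sup>2 - 2 * T * b * c" by (simp add: algebra_simps power2_eq_square)
    finally have 1: "0 \<le> q * b\<^sup>2 + c\<^sup>2 - 2 * T * b * c" .
    have "\<bar>(k + T) * (a * d)\<bar> \<le> ((1 + \<gamma>) * s) * \<bar>a * d\<bar>"
      using T(2) unfolding abs_mult by (intro mult_right_mono) auto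
    moreover have "0 \<le> (1 + \<gamma>) * (s * \<bar>a\<bar> - \<bar>d\<bar>)\<^sup>2" using \<gamma> by simp
    moreover have "(1 + \<gamma>) * (s * \<bar>a\<bar> - \<bar>d\<bar>)\<^sup>2 = (1 + \<gamma>) * (q * a\<^sup>2 + d\<^sup>2) - 2 * (((1 + \<gamma>) * s) * \<bar>a * d\<bar>)"
      unfolding s(2) by (simp add: algebra_simps power2_eq_square abs_mult)
    ultimately have 2: "0 \<le> (1 + \<gamma>) * (q * a\<^sup>2 + d\<^sup>2) + 2 * ((k + T) * (a * d))" by linarith
    have "q * (a\<^sup>2 + b\<^sup>2) + c\<^sup>2 + d\<^sup>2 + \<gamma> * (a + d) * (q * a + d) + 2 * T * (a * d - b * c) =
      (q * b\<^sup>2 + c\<^sup>2 - 2 * T * b * c) + ((1 + \<gamma>) * (q * a\<^sup>2 + d\<^sup>2) + 2 * ((k + T) * (a * d)))"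
      unfolding k_def by (simp add: algebra_simps power2_eq_square)
    with 1 2 show ?thesis by linarith
  qed
  then show ?thesis by blast
qed

text \<open>One \<open>w\<close> must serve all exponents, since \<open>r\<close> and
  \<open>r / 2\<close> occur together. At \<open>y = 0\<close> any unit vector will do: the outer
  product is multiplied by \<open>0\<close> if \<open>r = 0\<close>, and the whole matrix is if
  \<open>r > 0\<close>.\<close>

lemma powr_field_jacobian_frame:
  fixes y :: "real^2"
  obtains w where "norm w = 1"
    "\<And>r. 0 \<le> r \<Longrightarrow> powr_field_jacobian r y = abs_powr r y *\<^sub>R (mat 1 + r *\<^sub>R outer_product w w)"
proof (cases "y = 0")
  case True
  show thesis
    by (rule that[of "axis 1 1"]) (auto simp: norm_axis_1 powr_field_jacobian_def abs_powr_def True)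
next
  case False
  then show thesis
    by (intro that[of "sgn y"]) (auto simp: norm_sgn powr_field_jacobian_def)
qed

text \<open>In dimension two the determinant squares the factor \<open>|y|^(r/2)\<close>, so both
  terms carry the weight \<open>|y|^r\<close>. It factors out, and \<open>T\<close> can be chosen
  independently of \<open>y\<close> and \<open>M\<close>.\<close>

lemma elasticity_density_plus_det_nonneg:
  assumes r: "0 \<le> r" and crit: "\<bar>\<gamma>\<bar> * (r + 2) \<le> 2 * (2 + \<gamma>) * sqrt (r + 1)"
  shows "\<exists>T. \<forall>(y :: real^2) M. 0 \<le> elasticity_density \<gamma> M (powr_field_jacobian r y ** M)
    + T * det (powr_field_jacobian (r / 2) y ** M)"
proof -
  have "\<bar>\<gamma>\<bar> * ((r + 1) + 1) \<le> 2 * (2 + \<gamma>) * sqrt (r + 1)"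
    using crit by (simp add: add.assoc)
  then obtain T0 where T0: "0 \<le> (r + 1) * (a\<^sup>2 + b\<^sup>2) + c\<^sup>2 + d\<^sup>2
      + \<gamma> * (a + d) * ((r + 1) * a + d) + 2 * T0 * (a * d - b * c)" for a b c d
    using exists_null_lagrangian_multiplier[of "r + 1" \<gamma>] r by auto
  \<comment> \<open>The divisor cancels
    \<open>det (mat 1 + (r / 2) *\<^sub>R outer_product w w)\<close>.\<close>
  define T where "T = 2 * T0 / (1 + r / 2)"
  have "0 \<le> elasticity_density \<gamma> M (powr_field_jacobian r y ** M)
    + T * det (powr_field_jacobian (r / 2) y ** M)" for y :: "real^2" and M
  proof -
    obtain w where w: "norm w = 1"
      and pj: "\<And>r. 0 \<le> r \<Longrightarrow> powr_field_jacobian r y = abs_powr r y *\<^sub>R (mat 1 + r *\<^sub>R outer_product w w)"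
      by (rule powr_field_jacobian_frame[of y]) blast
    obtain a b c d where det: "det M = a * d - b * c"
      and dens: "\<And>r \<gamma>. elasticity_density \<gamma> M ((mat 1 + r *\<^sub>R outer_product w w) ** M) =
        (1 + r) * (a\<^sup>2 + b\<^sup>2) + c\<^sup>2 + d\<^sup>2 + \<gamma> * (a + d) * ((1 + r) * a + d)"
      by (rule orthonormal_frame_entries[OF w, of M]) blast
    have half: "(abs_powr (r / 2) y)\<^sup>2 = abs_powr r y"
      by (simp add: abs_powr_def power2_eq_square powr_add[symmetric])
    have nn: "0 \<le> abs_powr r y" by (simp add: abs_powr_def)
    have "det (powr_field_jacobian (r / 2) y) = abs_powr r y * (1 + r / 2)"
      using det_id_plus_outer_product[OF w, of "r / 2"] r
      by (simp add: pj det_scaleR_2 half)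
    then have "T * det (powr_field_jacobian (r / 2) y ** M) = abs_powr r y * (2 * T0 * (a * d - b * c))"
      using r by (simp add: det_mul det T_def)
    moreover have "elasticity_density \<gamma> M (powr_field_jacobian r y ** M) = abs_powr r y *
        ((r + 1) * (a\<^sup>2 + b\<^sup>2) + c\<^sup>2 + d\<^sup>2 + \<gamma> * (a + d) * ((r + 1) * a + d))"
      using r by (simp add: pj scaleR_matrix_mult_left elasticity_density_scaleR_right dens add.commute)
    ultimately show ?thesis
      using mult_nonneg_nonneg[OF nn T0[of a b c d]] by (simp add: distrib_left)
  qed
  then show ?thesis by blast
qed

text \<open>As \<open>T\<close> is constant, \<open>T\<close> times the determinant integrates to
  zero and may be added to the integrand, which then becomes pointwise nonnegative.\<close>

lemma elasticity_form_powr_field_nonneg: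
  assumes \<Omega>: "open \<Omega>" and r: "0 \<le> r" and "\<gamma> = inverse (1 - 2 * \<nu>)"
    and crit: "\<bar>\<gamma>\<bar> * (r + 2) \<le> 2 * (2 + \<gamma>) * sqrt (r + 1)"
    and u: "u \<in> C1_compact_support \<Omega>"
  shows "0 \<le> elasticity_form \<nu> \<Omega> u (\<lambda>x. (norm (u x) powr r) *\<^sub>R u x)"
proof -
  obtain S U J where U: "C1_supported_in S U J" and S: "S \<subseteq> \<Omega>" and eq: "\<And>x. x \<in> \<Omega> \<Longrightarrow> u x = U x"
    using C1_compact_support_extend[OF \<Omega> u] by blast
  have "bounded S" using U by (simp add: C1_supported_in_def compact_imp_bounded)
  then obtain a where box: "S \<subseteq> cbox (- a) a" using bounded_subset_cbox_symmetric by blast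
  note V = C1_supported_in_powr_field[OF r U]
  have W: "C1_supported_in S (\<lambda>x. (norm (U x) powr (r / 2)) *\<^sub>R U x) (\<lambda>x. powr_field_jacobian (r / 2) (U x) ** J x)"
    using C1_supported_in_powr_field[of "r / 2", OF _ U] r by simp
  obtain T where T: "\<And>(y :: real^2) M. 0 \<le> elasticity_density \<gamma> M (powr_field_jacobian r y ** M)
    + T * det (powr_field_jacobian (r / 2) y ** M)"
    using elasticity_density_plus_det_nonneg[OF r crit] by blast
  let ?F = "\<lambda>x. elasticity_density \<gamma> (J x) (powr_field_jacobian r (U x) ** J x)"
  let ?G = "\<lambda>x. det (powr_field_jacobian (r / 2) (U x) ** J x)"
  have contJ: "continuous_on X J" and contK: "continuous_on X (\<lambda>x. powr_field_jacobian r (U x) ** J x)"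
    and contL: "continuous_on X (\<lambda>x. powr_field_jacobian (r / 2) (U x) ** J x)" for X
    using U V W unfolding C1_supported_in_def by (meson continuous_on_subset subset_UNIV)+
  have F: "?F integrable_on cbox (- a) a"
    by (intro integrable_continuous continuous_on_elasticity_density contJ contK)
  have G: "?G integrable_on cbox (- a) a"
    unfolding det_2 by (intro integrable_continuous continuous_intros contL)
  have "elasticity_form \<nu> \<Omega> u (\<lambda>x. (norm (u x) powr r) *\<^sub>R u x) = integral (cbox (- a) a) ?F"
    unfolding \<open>\<gamma> = _\<close>
    by (rule elasticity_form_eq_integral[OF \<Omega> S box U V]) (simp_all add: eq)
  also have "\<dots> = integral (cbox (- a) a) ?F + T * integral (cbox (- a) a) ?G"
    using integral_det_jacobian_eq_0[OF W box] by simp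
  also have "\<dots> = integral (cbox (- a) a) (\<lambda>x. ?F x + T * ?G x)"
    by (rule integral_unique[symmetric])
      (intro has_integral_add has_integral_mult_right integrable_integral F G)
  also have "\<dots> \<ge> 0"
    by (intro integral_nonneg integrable_add integrable_on_mult_right F G T)
  finally show ?thesis .
qed

section \<open>Necessity\<close>

text \<open>Squaring the positive part makes it continuously differentiable: the derivatives on the
  two closed half-lines agree at \<open>0\<close>. This supplies the bump function for the test
  fields.\<close>

lemma has_real_derivative_max_0_square:
  "((\<lambda>t::real. (max 0 t)\<^sup>2) has_real_derivative 2 * max 0 t) (at t)"
proof -
  have eq: "(\<lambda>t::real. (max 0 t)\<^sup>2) = (\<lambda>t. if t \<in> {0..} then t\<^sup>2 else 0)"
    by (auto simp: fun_eq_iff max_def)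
  have "((\<lambda>t::real. if t \<in> {0..} then t\<^sup>2 else 0) has_vector_derivative
      (if t \<in> {0..} then 2 * t else 0)) (at t within {0..} \<union> {..0})"
    by (rule has_vector_derivative_If_within_closures)
      (auto intro!: derivative_eq_intros simp: has_real_derivative_iff_has_vector_derivative[symmetric])
  moreover have "{0..} \<union> {..0::real} = UNIV" by auto
  ultimately show ?thesis
    unfolding eq has_real_derivative_iff_has_vector_derivative
    by (simp add: max_def split: if_splits)
qed

lemma ball_bump_has_derivative:
  fixes x0 :: "'a::real_inner"
  shows "((\<lambda>x. (max 0 (\<rho>\<^sup>2 - (x - x0) \<bullet> (x - x0)))\<^sup>2) has_derivative
    (\<lambda>h. ((- 4 * max 0 (\<rho>\<^sup>2 - (x - x0) \<bullet> (x - x0))) *\<^sub>R (x - x0)) \<bullet> h)) (at x)"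
proof -
  have "((\<lambda>x. \<rho>\<^sup>2 - (x - x0) \<bullet> (x - x0)) has_derivative (\<lambda>h. - 2 * ((x - x0) \<bullet> h))) (at x)"
    by (auto intro!: derivative_eq_intros simp: inner_commute)
  from has_derivative_compose[OF this has_real_derivative_max_0_square[unfolded has_field_derivative_def]]
  show ?thesis by (simp add: mult_ac)
qed

text \<open>The amplitude \<open>\<epsilon>\<close> cancels the \<open>1 / \<epsilon>\<close>
  produced by differentiating the sine. For small \<open>\<epsilon>\<close> the field is close to
  \<open>\<psi> e\<close>, while its Jacobian keeps a rank-one oscillation of order one.\<close>

lemma C1_supported_in_oscillating:
  fixes \<psi> :: "real^2 \<Rightarrow> real" and G :: "real^2 \<Rightarrow> real^2"
  assumes "\<epsilon> \<noteq> 0" and S: "compact S" and zero: "\<And>x. x \<notin> S \<Longrightarrow> \<psi> x = 0"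
    and der: "\<And>x. (\<psi> has_derivative (\<lambda>h. G x \<bullet> h)) (at x)" and G: "continuous_on UNIV G"
  shows "C1_supported_in S
    (\<lambda>x. \<psi> x *\<^sub>R (e + (\<epsilon> * sin (\<xi> \<bullet> x / \<epsilon> + \<theta>)) *\<^sub>R v))
    (\<lambda>x. outer_product (e + (\<epsilon> * sin (\<xi> \<bullet> x / \<epsilon> + \<theta>)) *\<^sub>R v) (G x)
      + (\<psi> x * cos (\<xi> \<bullet> x / \<epsilon> + \<theta>)) *\<^sub>R outer_product v \<xi>)"
proof -
  have "((\<lambda>x. \<psi> x *\<^sub>R (e + (\<epsilon> * sin (\<xi> \<bullet> x / \<epsilon> + \<theta>)) *\<^sub>R v)) has_derivative
      (\<lambda>h. (outer_product (e + (\<epsilon> * sin (\<xi> \<bullet> x / \<epsilon> + \<theta>)) *\<^sub>R v) (G x)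
      + (\<psi> x * cos (\<xi> \<bullet> x / \<epsilon> + \<theta>)) *\<^sub>R outer_product v \<xi>) *v h)) (at x)" for x
  proof -
    have "((\<lambda>x. \<epsilon> * sin (\<xi> \<bullet> x / \<epsilon> + \<theta>)) has_derivative (\<lambda>h. cos (\<xi> \<bullet> x / \<epsilon> + \<theta>) * (\<xi> \<bullet> h))) (at x)"
      using \<open>\<epsilon> \<noteq> 0\<close> by (auto intro!: derivative_eq_intros)
    then have "((\<lambda>x. e + (\<epsilon> * sin (\<xi> \<bullet> x / \<epsilon> + \<theta>)) *\<^sub>R v) has_derivative
        (\<lambda>h. (cos (\<xi> \<bullet> x / \<epsilon> + \<theta>) * (\<xi> \<bullet> h)) *\<^sub>R v)) (at x)"
      by (intro has_derivative_eq_rhs[OF has_derivative_add[OF has_derivative_const has_derivative_scaleR_left]])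
        auto
    from has_derivative_scaleR[OF der this] show ?thesis
      by (simp add: outer_product_mult_vec matrix_vector_mult_add_rdistrib
          scaleR_matrix_vector_assoc[symmetric] algebra_simps)
  qed
  moreover have "continuous_on UNIV \<psi>"
    using der by (meson continuous_at_imp_continuous_on has_derivative_continuous)
  ultimately show ?thesis
    using S zero \<open>\<epsilon> \<noteq> 0\<close> unfolding C1_supported_in_def
    by (auto intro!: continuous_intros G)
qed

section \<open>The limit of rapid oscillation\<close>

lemma powr_field_jacobian_scaleR:
  assumes "0 < t"
  shows "powr_field_jacobian r (t *\<^sub>R z) = abs_powr r t *\<^sub>R powr_field_jacobian r z"
  using assms by (simp add: powr_field_jacobian_def abs_powr_def sgn_scaleR powr_mult)

lemma elasticity_density_quadratic:
  "elasticity_density \<gamma> (A + t *\<^sub>R B) (P ** (A + t *\<^sub>R B)) = elasticity_density \<gamma> A (P ** A)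
    + t * (elasticity_density \<gamma> A (P ** B) + elasticity_density \<gamma> B (P ** A))
    + t\<^sup>2 * elasticity_density \<gamma> B (P ** B)"
  by (simp add: elasticity_density_def trace_def sum_2 inner_vec_def matrix_matrix_mult_def
      algebra_simps power2_eq_square)

text \<open>
  The four phases are chosen so that the cosines sum to \<open>0\<close> and their squares to \<open>2\<close>; this
  replaces the Riemann-Lebesgue lemma.
\<close>

lemma sum_four_phases:
  fixes a b c :: real
  shows "(\<Sum>k<4. a + t * cos (\<tau> + real k * pi / 2) * b + (t * cos (\<tau> + real k * pi / 2))\<^sup>2 * c)
    = 4 * a + 2 * t\<^sup>2 * c"
proof -
  define C S where "C = cos \<tau>" and "S = sin \<tau>"
  have "cos (\<tau> + pi / 2) = - S" "cos (\<tau> + pi) = - C" "cos (\<tau> + 3 * pi / 2) = S"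
    using cos_3over2_pi sin_3over2_pi by (simp_all add: cos_add C_def S_def mult.commute)
  then have "(\<Sum>k<4. a + t * cos (\<tau> + real k * pi / 2) * b + (t * cos (\<tau> + real k * pi / 2))\<^sup>2 * c)
    = 4 * a + 2 * t\<^sup>2 * (C\<^sup>2 + S\<^sup>2) * c"
    by (simp add: eval_nat_numeral C_def[symmetric] algebra_simps)
  then show ?thesis by (simp add: C_def S_def)
qed

text \<open>By homogeneity the integrand for the oscillating field is \<open>|\<psi>|^r\<close>
  times a function \<open>F\<close> that stays continuous up to \<open>\<epsilon> = 0\<close>.
  Uniform continuity replaces \<open>\<epsilon>\<close> by \<open>0\<close>, and summing over four
  phases removes the term linear in the cosine.\<close>

lemma rank_one_scaled_condition:
  fixes v \<xi> e :: "real^2"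
  assumes \<Omega>: "open \<Omega>" and r: "0 \<le> r" and \<gamma>: "\<gamma> = inverse (1 - 2 * \<nu>)"
    and nonneg: "\<And>u. u \<in> C1_compact_support \<Omega> \<Longrightarrow>
      0 \<le> elasticity_form \<nu> \<Omega> u (\<lambda>x. (norm (u x) powr r) *\<^sub>R u x)"
    and S: "compact S" "S \<subseteq> \<Omega>" "S \<subseteq> cbox a b" and zero: "\<And>x. x \<notin> S \<Longrightarrow> \<psi> x = 0"
    and \<psi>: "\<And>x. 0 \<le> \<psi> x" "\<And>x. \<psi> x = 0 \<Longrightarrow> G x = 0"
    and der: "\<And>x. (\<psi> has_derivative (\<lambda>h. G x \<bullet> h)) (at x)" and G: "continuous_on UNIV G"
  shows "0 \<le> 4 * integral (cbox a b) (\<lambda>x. abs_powr r (\<psi> x) *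
        elasticity_density \<gamma> (outer_product e (G x)) (powr_field_jacobian r e ** outer_product e (G x)))
    + 2 * integral (cbox a b) (\<lambda>x. abs_powr r (\<psi> x) * (\<psi> x)\<^sup>2) *
        elasticity_density \<gamma> (outer_product v \<xi>) (powr_field_jacobian r e ** outer_product v \<xi>)"
    (is "0 \<le> 4 * ?I0 + 2 * ?I2 * ?Q")
proof -
  let ?B = "cbox a b"
  let ?w = "\<lambda>x. abs_powr r (\<psi> x)"
  \<comment> \<open>The sine and cosine values become independent variables \<open>s, c\<close> in
    \<open>[-1, 1]\<close>, because the phase \<open>\<xi> \<bullet> x / \<epsilon>\<close> itself
    has no limit.\<close>
  define F where "F = (\<lambda>(x, \<epsilon>, s, c).
    let M = outer_product (e + (\<epsilon> * s) *\<^sub>R v) (G x) + (\<psi> x * c) *\<^sub>R outer_product v \<xi>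
    in elasticity_density \<gamma> M (powr_field_jacobian r (e + (\<epsilon> * s) *\<^sub>R v) ** M))"
  have cont\<psi>: "continuous_on X \<psi>" for X
    using der by (meson continuous_at_imp_continuous_on has_derivative_continuous)
  have contw: "continuous_on X ?w" for X
    using continuous_on_compose2[OF continuous_on_abs_powr[OF r] cont\<psi>] by blast
  have comp: "continuous_on X (\<lambda>p. h (f p))" if "continuous_on UNIV h" "continuous_on X f"
    for X and h :: "real^2 \<Rightarrow> 'b::topological_space" and f :: "(real^2) \<times> real \<times> real \<times> real \<Rightarrow> real^2"
    using continuous_on_compose2[OF that] by blast
  have contF: "continuous_on X F" for X
    unfolding F_def Let_def case_prod_unfold
    by (intro continuous_intros comp[OF G] comp[OF cont\<psi>] comp[OF continuous_powr_field_jacobian[OF r]])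
  define K where "K = ?B \<times> {0..1::real} \<times> {-1..1::real} \<times> {-1..1::real}"
  have "compact K" unfolding K_def by (intro compact_Times compact_cbox compact_Icc)
  then have unif: "uniformly_continuous_on K F"
    by (intro compact_uniformly_continuous contF)
  \<comment> \<open>At \<open>\<epsilon> = 0\<close> the variable \<open>s\<close> drops out, so its
    values are arbitrary here.\<close>
  have F0: "(\<Sum>k<4. F (x, 0, s k, cos (\<tau> + real k * pi / 2))) =
      4 * elasticity_density \<gamma> (outer_product e (G x)) (powr_field_jacobian r e ** outer_product e (G x))
      + 2 * (\<psi> x)\<^sup>2 * ?Q" for x \<tau> s
    unfolding F_def by (simp add: elasticity_density_quadratic sum_four_phases)
  have intw: "?w integrable_on ?B" "(\<lambda>x. ?w x * (\<psi> x)\<^sup>2) integrable_on ?B"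
    "(\<lambda>x. ?w x * elasticity_density \<gamma> (outer_product e (G x)) (powr_field_jacobian r e ** outer_product e (G x)))
      integrable_on ?B"
    by (intro integrable_continuous continuous_intros contw cont\<psi> continuous_on_subset[OF G subset_UNIV])+
  have approx: "0 \<le> 4 * ?I0 + 2 * ?I2 * ?Q + 4 * \<eta> * integral ?B ?w" if "\<eta> > 0" for \<eta>
  proof -
    obtain \<delta> where \<delta>: "\<delta> > 0" "\<And>p p'. p \<in> K \<Longrightarrow> p' \<in> K \<Longrightarrow> dist p' p < \<delta> \<Longrightarrow> dist (F p') (F p) < \<eta>"
      using unif \<open>\<eta> > 0\<close> unfolding uniformly_continuous_on_def by metis
    define \<epsilon> where "\<epsilon> = min 1 (\<delta> / 2)"
    have \<epsilon>: "0 < \<epsilon>" "\<epsilon> \<le> 1" "\<epsilon> < \<delta>" using \<delta>(1) by (auto simp: \<epsilon>_def)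
    have near: "F (x, \<epsilon>, s, c) \<le> F (x, 0, s, c) + \<eta>" if "x \<in> ?B" "\<bar>s\<bar> \<le> 1" "\<bar>c\<bar> \<le> 1" for x s c
    proof -
      have "dist (F (x, \<epsilon>, s, c)) (F (x, 0, s, c)) < \<eta>"
        using that \<epsilon> by (intro \<delta>(2)) (auto simp: K_def dist_Pair_Pair)
      then show ?thesis by (simp add: dist_real_def)
    qed
    define \<theta> :: "real^2 \<Rightarrow> nat \<Rightarrow> real" where "\<theta> = (\<lambda>x k. \<xi> \<bullet> x / \<epsilon> + real k * pi / 2)"
    have cont\<theta>: "continuous_on X (\<lambda>x. \<theta> x k)" for X k
      unfolding \<theta>_def using \<epsilon>(1) by (intro continuous_intros) auto
    have contF': "continuous_on ?B (\<lambda>x. F (x, t, sin (\<theta> x k), cos (\<theta> x k)))" for t k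
      by (rule continuous_on_compose2[OF contF[of UNIV]]) (auto intro!: continuous_intros cont\<theta>)
    have step: "0 \<le> integral ?B (\<lambda>x. ?w x * F (x, \<epsilon>, sin (\<theta> x k), cos (\<theta> x k)))" for k
    proof -
      define z where "z = (\<lambda>x. e + (\<epsilon> * sin (\<xi> \<bullet> x / \<epsilon> + real k * pi / 2)) *\<^sub>R v)"
      define U where "U = (\<lambda>x. \<psi> x *\<^sub>R z x)"
      define J where "J = (\<lambda>x. outer_product (z x) (G x) +
        (\<psi> x * cos (\<xi> \<bullet> x / \<epsilon> + real k * pi / 2)) *\<^sub>R outer_product v \<xi>)"
      have U: "C1_supported_in S U J"
        unfolding U_def J_def z_def
        using \<epsilon>(1) by (intro C1_supported_in_oscillating S(1) zero der G) auto
      have "0 \<le> elasticity_form \<nu> \<Omega> U (\<lambda>x. (norm (U x) powr r) *\<^sub>R U x)"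
        by (rule nonneg[OF C1_supported_in_imp_C1_compact_support[OF \<Omega> S(2) U]])
      also have "\<dots> = integral ?B (\<lambda>x. elasticity_density \<gamma> (J x) (powr_field_jacobian r (U x) ** J x))"
        unfolding \<gamma> by (rule elasticity_form_eq_integral[OF \<Omega> S(2,3) U C1_supported_in_powr_field[OF r U]]) auto
      also have "\<dots> = integral ?B (\<lambda>x. ?w x * F (x, \<epsilon>, sin (\<theta> x k), cos (\<theta> x k)))"
      proof (rule arg_cong[where f = "integral ?B"], rule ext)
        fix x
        have FJ: "F (x, \<epsilon>, sin (\<theta> x k), cos (\<theta> x k)) = elasticity_density \<gamma> (J x) (powr_field_jacobian r (z x) ** J x)"
          by (simp add: F_def J_def z_def \<theta>_def Let_def)
        show "elasticity_density \<gamma> (J x) (powr_field_jacobian r (U x) ** J x) = ?w x * F (x, \<epsilon>, sin (\<theta> x k), cos (\<theta> x k))"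
        \<comment> \<open>The scaling rule for the power Jacobian requires a positive factor; where
          \<open>\<psi>\<close> vanishes so does \<open>G\<close>, hence all of
          \<open>J\<close>.\<close>
        proof (cases "\<psi> x = 0")
          case True
          then have "J x = 0" using \<psi>(2)[OF True] by (simp add: J_def outer_product_def vec_eq_iff)
          then show ?thesis unfolding FJ by (simp add: elasticity_density_def trace_def)
        next
          case False
          then have "\<psi> x > 0" using \<psi>(1)[of x] by simp
          then show ?thesis
            unfolding FJ U_def
            by (simp add: powr_field_jacobian_scaleR scaleR_matrix_mult_left elasticity_density_scaleR_right)
        qed
      qed
      finally show ?thesis .
    qed
    have w_nonneg: "0 \<le> ?w x" for x by (simp add: abs_powr_def)
    have "0 \<le> (\<Sum>k<4. integral ?B (\<lambda>x. ?w x * F (x, \<epsilon>, sin (\<theta> x k), cos (\<theta> x k))))"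
      by (intro sum_nonneg step)
    also have "\<dots> \<le> (\<Sum>k<4. integral ?B (\<lambda>x. ?w x * (F (x, 0, sin (\<theta> x k), cos (\<theta> x k)) + \<eta>)))"
      by (intro sum_mono integral_le mult_left_mono near w_nonneg integrable_continuous
          continuous_intros contw contF') auto
    also have "\<dots> = integral ?B (\<lambda>x. \<Sum>k<4. ?w x * (F (x, 0, sin (\<theta> x k), cos (\<theta> x k)) + \<eta>))"
      by (rule integral_sum[symmetric])
        (auto intro!: integrable_continuous continuous_intros contw contF')
    also have "(\<lambda>x. \<Sum>k<4. ?w x * (F (x, 0, sin (\<theta> x k), cos (\<theta> x k)) + \<eta>)) =
      (\<lambda>x. 4 * (?w x * elasticity_density \<gamma> (outer_product e (G x)) (powr_field_jacobian r e ** outer_product e (G x)))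
        + (2 * ?Q) * (?w x * (\<psi> x)\<^sup>2) + (4 * \<eta>) * ?w x)"
    proof
      fix x
      have "(\<Sum>k<4. ?w x * (F (x, 0, sin (\<theta> x k), cos (\<theta> x k)) + \<eta>)) =
        ?w x * ((\<Sum>k<4. F (x, 0, sin (\<theta> x k), cos (\<theta> x k))) + 4 * \<eta>)"
        by (simp add: sum_distrib_left[symmetric] sum.distrib)
      then show "(\<Sum>k<4. ?w x * (F (x, 0, sin (\<theta> x k), cos (\<theta> x k)) + \<eta>)) =
        4 * (?w x * elasticity_density \<gamma> (outer_product e (G x)) (powr_field_jacobian r e ** outer_product e (G x)))
        + (2 * ?Q) * (?w x * (\<psi> x)\<^sup>2) + (4 * \<eta>) * ?w x"
        using F0[of x "\<lambda>k. sin (\<theta> x k)" "\<xi> \<bullet> x / \<epsilon>"] by (simp add: \<theta>_def algebra_simps)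
    qed
    also have "integral ?B \<dots> = 4 * ?I0 + (2 * ?Q) * ?I2 + (4 * \<eta>) * integral ?B ?w"
      by (intro integral_unique has_integral_add has_integral_mult_right integrable_integral intw)
    finally show ?thesis by (simp add: mult_ac)
  qed
  show ?thesis
  proof (rule field_le_epsilon)
    fix d :: real assume "d > 0"
    define W where "W = integral ?B ?w"
    have W: "0 \<le> W" unfolding W_def by (intro integral_nonneg intw) (simp add: abs_powr_def)
    \<comment> \<open>This is the \<open>\<eta>\<close> that makes the error at most
      \<open>d\<close>; the \<open>+ 1\<close> covers \<open>W = 0\<close>.\<close>
    have "d / (4 * (W + 1)) > 0" using \<open>d > 0\<close> W by simp
    note approx[OF this, folded W_def]
    moreover have "4 * (d / (4 * (W + 1))) * W \<le> d"
      using \<open>d > 0\<close> W by (simp add: field_simps)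
    ultimately show "0 \<le> 4 * ?I0 + 2 * ?I2 * ?Q + d" by linarith
  qed
qed

text \<open>Replacing \<open>v\<close> by \<open>k *\<^sub>R v\<close> multiplies the rank-one term
  by \<open>k\<^sup>2\<close> and leaves \<open>I0\<close> unchanged. As \<open>I2 > 0\<close> for a
  bump on a ball in \<open>\<Omega>\<close>, a negative value would violate the scaled condition for
  large \<open>k\<close>.\<close>

lemma rank_one_condition:
  fixes v \<xi> e :: "real^2"
  assumes \<Omega>: "open \<Omega>" "\<Omega> \<noteq> {}" and r: "0 \<le> r" and \<gamma>: "\<gamma> = inverse (1 - 2 * \<nu>)"
    and nonneg: "\<And>u. u \<in> C1_compact_support \<Omega> \<Longrightarrow>
      0 \<le> elasticity_form \<nu> \<Omega> u (\<lambda>x. (norm (u x) powr r) *\<^sub>R u x)"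
  shows "0 \<le> elasticity_density \<gamma> (outer_product v \<xi>) (powr_field_jacobian r e ** outer_product v \<xi>)"
proof -
  obtain x0 where "x0 \<in> \<Omega>" using \<Omega>(2) by blast
  then obtain \<rho> where \<rho>: "\<rho> > 0" "cball x0 \<rho> \<subseteq> \<Omega>" using \<Omega>(1) open_contains_cball by blast
  obtain a where box: "cball x0 \<rho> \<subseteq> cbox (- a) a"
    using bounded_subset_cbox_symmetric[OF bounded_cball] .
  define m where "m = (\<lambda>x. max 0 (\<rho>\<^sup>2 - (x - x0) \<bullet> (x - x0)))"
  define \<psi> where "\<psi> = (\<lambda>x. (m x)\<^sup>2)"
  define G where "G = (\<lambda>x. (- 4 * m x) *\<^sub>R (x - x0))"
  have der: "(\<psi> has_derivative (\<lambda>h. G x \<bullet> h)) (at x)" for x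
    unfolding \<psi>_def G_def m_def by (rule ball_bump_has_derivative)
  have cont: "continuous_on X \<psi>" "continuous_on X G" for X
    unfolding \<psi>_def G_def m_def by (intro continuous_intros)+
  have zero: "\<psi> x = 0" if "x \<notin> cball x0 \<rho>" for x
  proof -
    have "\<rho>\<^sup>2 \<le> (norm (x - x0))\<^sup>2"
      using that \<rho>(1) by (intro power_mono) (auto simp: dist_norm norm_minus_commute)
    then show ?thesis by (simp add: \<psi>_def m_def dot_square_norm)
  qed
  let ?Q = "\<lambda>v. elasticity_density \<gamma> (outer_product v \<xi>) (powr_field_jacobian r e ** outer_product v \<xi>)"
  define I0 where "I0 = integral (cbox (- a) a) (\<lambda>x. abs_powr r (\<psi> x) *
        elasticity_density \<gamma> (outer_product e (G x)) (powr_field_jacobian r e ** outer_product e (G x)))"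
  define I2 where "I2 = integral (cbox (- a) a) (\<lambda>x. abs_powr r (\<psi> x) * (\<psi> x)\<^sup>2)"
  have cond: "0 \<le> 4 * I0 + 2 * I2 * ?Q v" for v
    unfolding I0_def I2_def
    by (rule rank_one_scaled_condition[OF \<Omega>(1) r \<gamma> nonneg compact_cball \<rho>(2) box zero _ _ der cont(2)])
      (auto simp: \<psi>_def G_def)
  have "continuous_on X (\<lambda>x. abs_powr r (\<psi> x))" for X
    using continuous_on_compose2[OF continuous_on_abs_powr[OF r] cont(1)] by blast
  then have cont2: "continuous_on X (\<lambda>x. abs_powr r (\<psi> x) * (\<psi> x)\<^sup>2)" for X
    by (intro continuous_intros cont)
  have "I2 > 0"
  proof -
    have "I2 \<ge> 0" unfolding I2_def
      by (intro integral_nonneg integrable_continuous cont2) (simp add: abs_powr_def)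
    moreover have "I2 \<noteq> 0"
    proof
      assume "I2 = 0"
      \<comment> \<open>The box thus has nonempty interior, so a nonnegative continuous function
        with zero integral vanishes on it, in particular at \<open>x0\<close>.\<close>
      have "ball x0 \<rho> \<subseteq> interior (cbox (- a) a)"
        using box by (intro interior_maximal) (auto intro: less_imp_le)
      then have x0: "x0 \<in> box (- a) a" using \<rho>(1) by (auto simp: interior_cbox)
      have "((\<lambda>x. abs_powr r (\<psi> x) * (\<psi> x)\<^sup>2) has_integral 0) (cbox (- a) a)"
        using integrable_integral[OF integrable_continuous[OF cont2], of "- a" a]
        unfolding I2_def[symmetric] \<open>I2 = 0\<close> .
      then have "abs_powr r (\<psi> x0) * (\<psi> x0)\<^sup>2 = 0"
        using x0 box_subset_cbox[of "- a" a]
        by (intro has_integral_0_cbox_imp_0[OF cont2]) (auto simp: abs_powr_def)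
      moreover have "\<psi> x0 > 0" using \<rho>(1) by (simp add: \<psi>_def m_def)
      ultimately show False by (auto simp: abs_powr_def split: if_splits)
    qed
    ultimately show ?thesis by simp
  qed
  have scale: "?Q (k *\<^sub>R v) = k\<^sup>2 * ?Q v" for k
  proof -
    have "outer_product (k *\<^sub>R v) \<xi> = k *\<^sub>R outer_product v \<xi>"
      by (simp add: outer_product_def vec_eq_iff)
    then show ?thesis
      using elasticity_density_quadratic[of \<gamma> 0 k "outer_product v \<xi>" "powr_field_jacobian r e"]
      by (simp add: elasticity_density_def trace_def)
  qed
  show ?thesis
  proof (rule ccontr)
    assume "\<not> 0 \<le> ?Q v"
    define Y where "Y = 2 * I2 * ?Q v"
    have "Y < 0" using \<open>\<not> 0 \<le> ?Q v\<close> \<open>I2 > 0\<close> by (simp add: Y_def mult_less_0_iff)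
    \<comment> \<open>With this \<open>k\<close>, the scaled condition would read
      \<open>0 \<le> 4 * I0 - 4 * \<bar>I0\<bar> - 1\<close>.\<close>
    define k where "k = sqrt ((4 * \<bar>I0\<bar> + 1) / - Y)"
    have "0 \<le> (4 * \<bar>I0\<bar> + 1) / - Y" using \<open>Y < 0\<close> by (intro divide_nonneg_pos) auto
    then have "k\<^sup>2 * Y = - (4 * \<bar>I0\<bar> + 1)"
      unfolding k_def using \<open>Y < 0\<close> by (simp only: real_sqrt_pow2) simp
    moreover have "2 * I2 * ?Q (k *\<^sub>R v) = k\<^sup>2 * Y"
      unfolding scale by (simp add: Y_def)
    ultimately show False using cond[of "k *\<^sub>R v"] by linarith
  qed
qed

text \<open>For general \<open>l\<close> the value is \<open>(2 + \<gamma>) * (r + 1 + l\<^sup>2) +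
  \<gamma> * (r + 2) * l\<close>. If \<open>2 + \<gamma> > 0\<close>, its quotient by
  \<open>\<bar>l\<bar>\<close> is least, for either sign of \<open>l\<close>, when
  \<open>l\<^sup>2 = r + 1\<close>, so this choice gives the sharp condition.\<close>

lemma rank_one_density:
  assumes "l\<^sup>2 = r + 1"
  shows "elasticity_density \<gamma> (outer_product (vector [1, l]) (vector [1, 1]))
      (powr_field_jacobian r (axis 1 1) ** outer_product (vector [1, l]) (vector [1, 1] :: real^2))
    = 2 * (2 + \<gamma>) * (r + 1) + \<gamma> * (r + 2) * l"
proof -
  let ?P = "powr_field_jacobian r (axis 1 1 :: real^2)"
  have "?P $ 1 $ 1 = r + 1" "?P $ 1 $ 2 = 0" "?P $ 2 $ 1 = 0" "?P $ 2 $ 2 = 1"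
    by (simp_all add: powr_field_jacobian_def abs_powr_def sgn_div_norm norm_axis_1 mat_def outer_product_def)
      (simp_all add: axis_def)
  then have "elasticity_density \<gamma> (outer_product (vector [1, l]) (vector [1, 1]))
      (?P ** outer_product (vector [1, l]) (vector [1, 1])) = 2 * (r + 1) + 2 * l\<^sup>2 + \<gamma> * ((1 + l) * (r + 1 + l))"
    by (simp add: elasticity_density_def trace_def outer_product_def sum_2 inner_vec_def
        matrix_matrix_mult_def vector_2 algebra_simps power2_eq_square)
  also have "(1 + l) * (r + 1 + l) = (r + 1) + l\<^sup>2 + (r + 2) * l"
    by (simp add: algebra_simps power2_eq_square)
  finally show ?thesis unfolding assms by (simp add: algebra_simps)
qed

section \<open>The criterion in terms of \<open>\<gamma>\<close>, then of \<open>p\<close> and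
  \<open>\<nu>\<close>\<close>

lemma elasticity_form_powr_field_nonneg_iff:
  assumes \<Omega>: "open \<Omega>" "\<Omega> \<noteq> {}" and r: "0 \<le> r" and \<gamma>: "\<gamma> = inverse (1 - 2 * \<nu>)"
  shows "(\<forall>u \<in> C1_compact_support \<Omega>. 0 \<le> elasticity_form \<nu> \<Omega> u (\<lambda>x. (norm (u x) powr r) *\<^sub>R u x))
    \<longleftrightarrow> \<bar>\<gamma>\<bar> * (r + 2) \<le> 2 * (2 + \<gamma>) * sqrt (r + 1)"
proof
  assume *: "\<forall>u \<in> C1_compact_support \<Omega>. 0 \<le> elasticity_form \<nu> \<Omega> u (\<lambda>x. (norm (u x) powr r) *\<^sub>R u x)"
  define s where "s = sqrt (r + 1)"
  have s: "s > 0" "s\<^sup>2 = r + 1" using r by (auto simp: s_def)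
  have "0 \<le> 2 * (2 + \<gamma>) * (r + 1) + \<gamma> * (r + 2) * l" if "l\<^sup>2 = r + 1" for l
    using rank_one_condition[OF \<Omega> r \<gamma>, of "vector [1, l]" "vector [1, 1]" "axis 1 1"] *
    unfolding rank_one_density[OF that] by blast
  \<comment> \<open>The two signs of \<open>l\<close> together bound the absolute value; a factor
    \<open>s\<close> is then cancelled.\<close>
  from this[of s] this[of "- s"] have "- (2 * (2 + \<gamma>) * s\<^sup>2) \<le> \<gamma> * (r + 2) * s" "\<gamma> * (r + 2) * s \<le> 2 * (2 + \<gamma>) * s\<^sup>2"
    using s by auto
  then have "\<bar>\<gamma> * (r + 2) * s\<bar> \<le> 2 * (2 + \<gamma>) * s\<^sup>2" by linarith
  then have "(\<bar>\<gamma>\<bar> * (r + 2)) * s \<le> (2 * (2 + \<gamma>) * s) * s"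
    using r s(1) by (simp add: abs_mult power2_eq_square mult_ac)
  then show "\<bar>\<gamma>\<bar> * (r + 2) \<le> 2 * (2 + \<gamma>) * sqrt (r + 1)"
    using s(1) unfolding s_def[symmetric] by (rule mult_right_le_imp_le)
next
  assume "\<bar>\<gamma>\<bar> * (r + 2) \<le> 2 * (2 + \<gamma>) * sqrt (r + 1)"
  then show "\<forall>u \<in> C1_compact_support \<Omega>. 0 \<le> elasticity_form \<nu> \<Omega> u (\<lambda>x. (norm (u x) powr r) *\<^sub>R u x)"
    using elasticity_form_powr_field_nonneg[OF \<Omega>(1) r \<gamma>] by blast
qed

text \<open>In terms of \<open>\<gamma>\<close> the bound on the right is
  \<open>(1 + \<gamma>) / (2 + \<gamma>)\<^sup>2\<close>, where \<open>\<nu> \<noteq> 3 / 4\<close>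
  means \<open>2 + \<gamma> \<noteq> 0\<close>. Clearing denominators gives the square of the
  inequality on the left.\<close>

lemma exponent_condition_iff:
  fixes p \<nu> \<gamma> :: real
  assumes p: "2 \<le> p" and \<nu>: "\<nu> \<noteq> 1 / 2" "\<nu> \<noteq> 3 / 4" and \<gamma>: "\<gamma> = inverse (1 - 2 * \<nu>)"
  shows "\<bar>\<gamma>\<bar> * p \<le> 2 * (2 + \<gamma>) * sqrt (p - 1) \<longleftrightarrow>
    (1 / 2 - 1 / p)\<^sup>2 \<le> 2 * (\<nu> - 1) * (2 * \<nu> - 1) / (3 - 4 * \<nu>)\<^sup>2"
proof -
  define D where "D = 1 - 2 * \<nu>"
  have D: "D \<noteq> 0" "\<gamma> = 1 / D" using \<nu> \<gamma> by (auto simp: D_def inverse_eq_divide)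
  have E: "2 * D + 1 \<noteq> 0" using \<nu> by (simp add: D_def)
  have "2 * (\<nu> - 1) * (2 * \<nu> - 1) / (3 - 4 * \<nu>)\<^sup>2 = (D\<^sup>2 + D) / (2 * D + 1)\<^sup>2"
  proof -
    have "2 * (\<nu> - 1) * (2 * \<nu> - 1) = D\<^sup>2 + D"
      by (simp add: D_def power2_eq_square algebra_simps)
    moreover have "3 - 4 * \<nu> = 2 * D + 1" by (simp add: D_def)
    ultimately show ?thesis by (simp only:)
  qed
  also have "\<dots> = (1 + \<gamma>) / (2 + \<gamma>)\<^sup>2"
    using D(1) E by (simp add: D(2) power2_eq_square divide_simps) (simp add: algebra_simps)
  finally have rhs: "2 * (\<nu> - 1) * (2 * \<nu> - 1) / (3 - 4 * \<nu>)\<^sup>2 = (1 + \<gamma>) / (2 + \<gamma>)\<^sup>2" .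
  have "2 + \<gamma> = (2 * D + 1) / D" using D by (simp add: field_simps)
  then have g: "(2 + \<gamma>)\<^sup>2 > 0" using D E by simp
  have lhs: "(1 / 2 - 1 / p)\<^sup>2 = (p - 2)\<^sup>2 / (4 * p\<^sup>2)"
    using p by (simp add: power2_eq_square field_simps)
  have "(1 / 2 - 1 / p)\<^sup>2 \<le> (1 + \<gamma>) / (2 + \<gamma>)\<^sup>2 \<longleftrightarrow> (p - 2)\<^sup>2 * (2 + \<gamma>)\<^sup>2 \<le> (1 + \<gamma>) * (4 * p\<^sup>2)"
  proof -
    have "x / b \<le> y / d \<longleftrightarrow> x * d \<le> y * b" if "0 < b" "0 < d" for x y b d :: real
      using that by (simp add: field_simps)
    then show ?thesis unfolding lhs using g p by simp
  qed
  also have "\<dots> \<longleftrightarrow> (\<gamma> * p)\<^sup>2 \<le> (2 * (2 + \<gamma>))\<^sup>2 * (p - 1)"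
  proof -
    \<comment> \<open>Combines \<open>4 * (p - 1) = p\<^sup>2 - (p - 2)\<^sup>2\<close> with
      \<open>(2 + \<gamma>)\<^sup>2 - \<gamma>\<^sup>2 = 4 * (1 + \<gamma>)\<close>.\<close>
    have "(2 * (2 + \<gamma>))\<^sup>2 * (p - 1) - (\<gamma> * p)\<^sup>2 = (1 + \<gamma>) * (4 * p\<^sup>2) - (p - 2)\<^sup>2 * (2 + \<gamma>)\<^sup>2"
      by (simp add: power2_eq_square algebra_simps)
    then show ?thesis by linarith
  qed
  finally have eq: "(1 / 2 - 1 / p)\<^sup>2 \<le> (1 + \<gamma>) / (2 + \<gamma>)\<^sup>2 \<longleftrightarrow> (\<gamma> * p)\<^sup>2 \<le> (2 * (2 + \<gamma>) * sqrt (p - 1))\<^sup>2"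
    using p by (simp add: power_mult_distrib)
  have "(1 / 2 - 1 / p)\<^sup>2 \<le> (1 + \<gamma>) / (2 + \<gamma>)\<^sup>2 \<longleftrightarrow> \<bar>\<gamma> * p\<bar> \<le> 2 * (2 + \<gamma>) * sqrt (p - 1)"
    (is "?A \<longleftrightarrow> \<bar>?X\<bar> \<le> ?Y")
  proof
    assume ?A
    \<comment> \<open>Taking roots requires \<open>?Y\<close> to be nonnegative. This follows from
      \<open>?A\<close>, whose left side is a square, so that \<open>1 + \<gamma>\<close> cannot be
      negative.\<close>
    then have "0 \<le> (1 + \<gamma>) / (2 + \<gamma>)\<^sup>2" using zero_le_power2[of "1 / 2 - 1 / p"] by linarith
    then have "0 \<le> 1 + \<gamma>" using g by (simp add: zero_le_divide_iff)
    then have "0 \<le> ?Y" using p by simp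
    moreover have "\<bar>?X\<bar> \<le> \<bar>?Y\<bar>" using \<open>?A\<close> unfolding eq abs_le_square_iff .
    ultimately show "\<bar>?X\<bar> \<le> ?Y" by linarith
  next
    assume "\<bar>?X\<bar> \<le> ?Y"
    then have "\<bar>?X\<bar> \<le> \<bar>?Y\<bar>" by linarith
    then show ?A unfolding eq abs_le_square_iff .
  qed
  then show ?thesis unfolding rhs using p by (simp add: abs_mult)
qed

lemma elasticity_form_commute: "elasticity_form \<nu> \<Omega> u v = elasticity_form \<nu> \<Omega> v u"
  by (simp add: elasticity_form_def inner_commute mult.commute)

theorem theorem3:
  fixes \<Omega> :: "(real^2) set" and p \<nu> :: real
  assumes "open \<Omega>" and "connected \<Omega>" and "\<Omega> \<noteq> {}"
    and "1 < p"
    and "\<nu> \<noteq> 1 / 2" and "\<nu> \<noteq> 3 / 4"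
  shows "Lp_dissipative_elasticity p \<nu> \<Omega> \<longleftrightarrow>
    (1 / 2 - 1 / p)\<^sup>2 \<le> 2 * (\<nu> - 1) * (2 * \<nu> - 1) / (3 - 4 * \<nu>)\<^sup>2"
proof -
  have main: "(\<forall>u \<in> C1_compact_support \<Omega>. 0 \<le> elasticity_form \<nu> \<Omega> u (\<lambda>x. (norm (u x) powr (q - 2)) *\<^sub>R u x))
    \<longleftrightarrow> (1 / 2 - 1 / q)\<^sup>2 \<le> 2 * (\<nu> - 1) * (2 * \<nu> - 1) / (3 - 4 * \<nu>)\<^sup>2" if "2 \<le> q" for q
    using elasticity_form_powr_field_nonneg_iff[OF assms(1,3) _ refl, of "q - 2" \<nu>]
      exponent_condition_iff[OF that assms(5,6) refl] that by simp
  show ?thesis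
  proof (cases "2 \<le> p")
    case True
    then show ?thesis using main[OF True] by (simp add: Lp_dissipative_elasticity_def)
  next
    case False
    \<comment> \<open>For \<open>p < 2\<close> the definition uses the conjugate exponent with the
      arguments exchanged. Symmetry of the form undoes the exchange, and conjugation only changes
      the sign of \<open>1 / 2 - 1 / p\<close>.\<close>
    then have "2 \<le> p / (p - 1)" using assms(4) by (simp add: field_simps)
    note main[OF this]
    also have "1 / 2 - 1 / (p / (p - 1)) = - (1 / 2 - 1 / p)" using assms(4) by (simp add: field_simps)
    finally show ?thesis
      using False unfolding power2_minus
      by (simp add: Lp_dissipative_elasticity_def elasticity_form_commute[of \<nu> \<Omega> "\<lambda>x. _ x *\<^sub>R _ x"])
  qed
qed

end
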